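(* For every integer $n\ge 4$ there exist $X_1,X_2>0$, an integer $m\ge 1$ and matrices $A\in\mathbb{C}^{n\times n}$, $B\in\mathbb{C}^{n\times m}$ such that $\ker(\theta-A^* )\cap\ker B^*=\{0\}$ for every eigenvalue $\theta$ of $A^*$ and such that, with $\Omega=(0,X_1)\times(0,X_2)$ and $\gamma=\gamma_L\cup\gamma_T$, where $\gamma_L=\{0\}\times(0,X_2)$ and $\gamma_T=(0,X_1)\times\{X_2\}$, the system $$\left\{\begin{array}{ll} \partial_t y = \overrightarrow{\Delta} y + A y & \text{in } (0,T)\times\Omega,\\ y = 1_\gamma B g & \text{on } (0,T)\times\partial\Omega,\\ y(0)=y_0 & \text{in }\Omega,\end{array}\right.$$ is not approximately controllable.
   Context: $\overrightarrow{\Delta}$ is the Laplacian acting componentwise on $\mathbb{C}^n$-valued functions. $A^*,B^*$ are conjugate transposes and $\partial_n$ is the outward normal derivative. Solutions: for $y_0\in H^{-1}(\Omega)^n$ and $g\in L^2(0,T;L^2(\partial\Omega)^m)$ there is a unique solution by transposition $y\in C^0([0,T];H^{-1}(\Omega)^n)\cap L^2(0,T;L^2(\Omega)^n)$, characterized by: for all $\tau\in[0,T]$ and $\zeta\in H^1_0(\Omega)^n$, $\langle y(\tau),\zeta\rangle-\langle y_0,z(0)\rangle=-\int_0^\tau\int_\gamma Bg\cdot\overline{\partial_n z}$, where $z$ solves $-\partial_t z=\overrightarrow{\Delta}z+A^*z$ in $(0,\tau)\times\Omega$, $z=0$ on $\partial\Omega$, $z(\tau)=\zeta$. Approximate controllability: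 the system is approximately controllable at time $T$ if for all $y_0,y_1\in H^{-1}(\Omega)^n$ and $\epsilon>0$ there is $g\in L^2(0,T;L^2(\partial\Omega)^m)$ whose solution satisfies $\|y(T)-y_1\|_{H^{-1}(\Omega)^n}\le\epsilon$; it is approximately controllable if this holds for every $T>0$. *)

theory Defs
  imports "HOL-Analysis.Analysis" "Jordan_Normal_Form.Schur_Decomposition"
    "Jordan_Normal_Form.Matrix_Kernel"
begin

text \<open>Elements of \<open>X\<^sup>n\<close>, for a function space \<open>X\<close>, are families indexed by \<open>nat\<close> of which only
  the components \<open>i < n\<close> matter.  Points of the space-time cylinder are pairs \<open>(t, x)\<close> with
  \<open>x :: real \<times> real\<close>.\<close>

section \<open>Square-integrable functions\<close>

definition square_integrable :: "'a measure \<Rightarrow> ('a \<Rightarrow> complex) \<Rightarrow> bool" where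
  "square_integrable M f \<longleftrightarrow> f \<in> borel_measurable M \<and> integrable M (\<lambda>x. (cmod (f x))\<^sup>2)"

text \<open>Only meaningful for square-integrable \<open>f\<close> (otherwise the Bochner integral defaults to 0);
  it is only ever applied to such functions below.\<close>

definition L2norm :: "'a measure \<Rightarrow> ('a \<Rightarrow> complex) \<Rightarrow> real" where
  "L2norm M f = sqrt (\<integral>x. (cmod (f x))\<^sup>2 \<partial>M)"

abbreviation lborel_on :: "'a::euclidean_space set \<Rightarrow> 'a measure" where
  "lborel_on S \<equiv> restrict_space lborel S"

section \<open>Smooth functions and test functions\<close>

text \<open>In finite dimension, being \<open>k\<close> times continuously differentiable amounts to
  differentiability with all directional derivatives \<open>k - 1\<close> times continuously differentiable.\<close>

fun cont_diff :: "nat \<Rightarrow> ('a::euclidean_space \<Rightarrow> complex) \<Rightarrow> bool" where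
  "cont_diff 0 f \<longleftrightarrow> continuous_on UNIV f"
| "cont_diff (Suc k) f \<longleftrightarrow> (\<forall>x. f differentiable (at x)) \<and>
     (\<forall>v. cont_diff k (\<lambda>x. frechet_derivative f (at x) v))"

definition smooth_fun :: "('a::euclidean_space \<Rightarrow> complex) \<Rightarrow> bool" where
  "smooth_fun f \<longleftrightarrow> (\<forall>k. cont_diff k f)"

definition test_functions :: "'a::euclidean_space set \<Rightarrow> ('a \<Rightarrow> complex) set" where
  "test_functions S = {\<phi>. smooth_fun \<phi> \<and> compact (closure {x. \<phi> x \<noteq> 0}) \<and>
     closure {x. \<phi> x \<noteq> 0} \<subseteq> S}"

section \<open>Sobolev spaces on an open set\<close>

text \<open>\<open>v \<in> L\<^sup>2(S)\<close> is the weak derivative of \<open>u \<in> L\<^sup>2(S)\<close> in direction \<open>b\<close>.\<close>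

definition is_weak_deriv ::
  "'a::euclidean_space set \<Rightarrow> 'a \<Rightarrow> ('a \<Rightarrow> complex) \<Rightarrow> ('a \<Rightarrow> complex) \<Rightarrow> bool" where
  "is_weak_deriv S b u v \<longleftrightarrow>
     square_integrable (lborel_on S) u \<and> square_integrable (lborel_on S) v \<and>
     (\<forall>\<phi>\<in>test_functions S.
        (\<integral>x. u x * frechet_derivative \<phi> (at x) b \<partial>lborel_on S) =
        - (\<integral>x. v x * \<phi> x \<partial>lborel_on S))"

text \<open>The weak derivative is unique up to null sets, so the choice does not affect the norm.\<close>

definition weak_deriv ::
  "'a::euclidean_space set \<Rightarrow> 'a \<Rightarrow> ('a \<Rightarrow> complex) \<Rightarrow> 'a \<Rightarrow> complex" where
  "weak_deriv S b u = (SOME v. is_weak_deriv S b u v)"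

definition H1_norm :: "'a::euclidean_space set \<Rightarrow> ('a \<Rightarrow> complex) \<Rightarrow> real" where
  "H1_norm S u =
     sqrt ((L2norm (lborel_on S) u)\<^sup>2 + (\<Sum>b\<in>Basis. (L2norm (lborel_on S) (weak_deriv S b u))\<^sup>2))"

text \<open>Convergence in \<open>H\<^sup>1(S)\<close> of smooth functions \<open>U k\<close>, of finite \<open>H\<^sup>1(S)\<close> norm, to
  \<open>u \<in> H\<^sup>1(S)\<close>.\<close>

definition H1_approximates ::
  "'a::euclidean_space set \<Rightarrow> (nat \<Rightarrow> 'a \<Rightarrow> complex) \<Rightarrow> ('a \<Rightarrow> complex) \<Rightarrow> bool" where
  "H1_approximates S U u \<longleftrightarrow>
     (\<lambda>k. L2norm (lborel_on S) (\<lambda>x. U k x - u x)) \<longlonglongrightarrow> 0 \<and>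
     (\<forall>b\<in>Basis. \<exists>v. is_weak_deriv S b u v \<and>
        (\<lambda>k. L2norm (lborel_on S) (\<lambda>x. frechet_derivative (U k) (at x) b - v x)) \<longlonglongrightarrow> 0)"

definition H10 :: "'a::euclidean_space set \<Rightarrow> ('a \<Rightarrow> complex) set" where
  "H10 S = {u. \<exists>U. (\<forall>k. U k \<in> test_functions S) \<and> H1_approximates S U u}"

text \<open>\<open>H\<^sup>-\<^sup>1\<close> as the space of bounded \<^emph>\<open>antilinear\<close> functionals on \<open>H\<^sup>1\<^sub>0\<close>: the duality
  \<open>\<langle>F, \<zeta>\<rangle> = F \<zeta>\<close> extends \<open>\<integral> f * cnj \<zeta>\<close>.  Values of the functional outside \<open>H\<^sup>1\<^sub>0\<close> are irrelevant;
  the bound makes it insensitive to changes of \<open>\<zeta>\<close> on null sets.\<close>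

definition Hm1 :: "'a::euclidean_space set \<Rightarrow> (('a \<Rightarrow> complex) \<Rightarrow> complex) set" where
  "Hm1 S = {F. (\<forall>u\<in>H10 S. \<forall>v\<in>H10 S. F (\<lambda>x. u x + v x) = F u + F v) \<and>
     (\<forall>c. \<forall>u\<in>H10 S. F (\<lambda>x. c * u x) = cnj c * F u) \<and>
     (\<exists>C. \<forall>u\<in>H10 S. cmod (F u) \<le> C * H1_norm S u)}"

definition Hm1_norm ::
  "'a::euclidean_space set \<Rightarrow> (('a \<Rightarrow> complex) \<Rightarrow> complex) \<Rightarrow> real" where
  "Hm1_norm S F = (SUP u\<in>H10 S. cmod (F u) / H1_norm S u)"

definition Hm1_norm_vec ::
  "nat \<Rightarrow> 'a::euclidean_space set \<Rightarrow> (nat \<Rightarrow> ('a \<Rightarrow> complex) \<Rightarrow> complex) \<Rightarrow> real" where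
  "Hm1_norm_vec n S F = sqrt (\<Sum>i<n. (Hm1_norm S (F i))\<^sup>2)"

section \<open>The rectangle, its boundary, and traces\<close>

definition rectangle :: "real \<Rightarrow> real \<Rightarrow> (real \<times> real) set" where
  "rectangle X1 X2 = {0<..<X1} \<times> {0<..<X2}"

definition boundary_param :: "real \<Rightarrow> real \<Rightarrow> real \<Rightarrow> real \<times> real" where
  "boundary_param X1 X2 s =
     (if s \<le> X1 then (s, 0)
      else if s \<le> X1 + X2 then (X1, s - X1)
      else if s \<le> 2 * X1 + X2 then (2 * X1 + X2 - s, X2)
      else (0, 2 * X1 + 2 * X2 - s))"

text \<open>Arc length on the boundary, as a Borel measure on the plane concentrated there.\<close>

definition boundary_measure :: "real \<Rightarrow> real \<Rightarrow> (real \<times> real) measure" where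
  "boundary_measure X1 X2 =
     distr (lborel_on {0..2 * X1 + 2 * X2}) borel (boundary_param X1 X2)"

text \<open>Outward unit normal; its values at the four corners (a null set) are arbitrary.\<close>

definition outward_normal :: "real \<Rightarrow> real \<Rightarrow> real \<times> real \<Rightarrow> real \<times> real" where
  "outward_normal X1 X2 x =
     (if fst x = 0 then (-1, 0)
      else if fst x = X1 then (1, 0)
      else if snd x = 0 then (0, -1)
      else (0, 1))"

text \<open>\<open>w \<in> L\<^sup>2(\<partial>\<Omega>)\<close> is the trace of \<open>u \<in> H\<^sup>1(\<Omega>)\<close>: the trace operator is the continuous extension of
  the restriction to \<open>\<partial>\<Omega>\<close> of functions smooth up to the boundary.\<close>

definition has_trace ::
  "real \<Rightarrow> real \<Rightarrow> (real \<times> real \<Rightarrow> complex) \<Rightarrow> (real \<times> real \<Rightarrow> complex) \<Rightarrow> bool" where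
  "has_trace X1 X2 u w \<longleftrightarrow> square_integrable (boundary_measure X1 X2) w \<and>
     (\<exists>U. (\<forall>k. smooth_fun (U k)) \<and> H1_approximates (rectangle X1 X2) U u \<and>
        (\<lambda>k. L2norm (boundary_measure X1 X2) (\<lambda>x. U k x - w x)) \<longlonglongrightarrow> 0)"

text \<open>\<open>q\<close> is the outward normal derivative of \<open>u \<in> H\<^sup>2(\<Omega>)\<close>, i.e. the normal component of the trace
  of its gradient.\<close>

definition has_normal_deriv ::
  "real \<Rightarrow> real \<Rightarrow> (real \<times> real \<Rightarrow> complex) \<Rightarrow> (real \<times> real \<Rightarrow> complex) \<Rightarrow> bool" where
  "has_normal_deriv X1 X2 u q \<longleftrightarrow>
     (\<exists>v w. (\<forall>b\<in>Basis. is_weak_deriv (rectangle X1 X2) b u (v b) \<and> has_trace X1 X2 (v b) (w b)) \<and>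
        (AE x in boundary_measure X1 X2.
           q x = (\<Sum>b\<in>Basis. of_real (inner (outward_normal X1 X2 x) b) * w b x)))"

section \<open>The adjoint system\<close>

definition cylinder :: "real \<Rightarrow> real \<Rightarrow> real \<Rightarrow> (real \<times> real \<times> real) set" where
  "cylinder X1 X2 T = {0<..<T} \<times> rectangle X1 X2"

definition boundary_cylinder_measure ::
  "real \<Rightarrow> real \<Rightarrow> real \<Rightarrow> (real \<times> real \<times> real) measure" where
  "boundary_cylinder_measure X1 X2 T = lborel_on {0<..<T} \<Otimes>\<^sub>M boundary_measure X1 X2"

text \<open>\<open>z\<close> is the solution of \<open>-\<partial>\<^sub>t z = \<Delta> z + A\<^sup>* z\<close> in \<open>(0,\<tau>) \<times> \<Omega>\<close>, \<open>z = 0\<close> on \<open>\<partial>\<Omega>\<close>, \<open>z(\<tau>) = \<zeta>\<close> in the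
  maximal regularity class \<open>H\<^sup>1(0,\<tau>; L\<^sup>2) \<inter> L\<^sup>2(0,\<tau>; H\<^sup>2 \<inter> H\<^sup>1\<^sub>0)\<close>, the natural one for \<open>\<zeta> \<in> H\<^sup>1\<^sub>0\<close> since \<open>\<Omega>\<close> is
  convex.  This class embeds into \<open>C([0,\<tau>]; H\<^sup>1\<^sub>0)\<close>; the first two conditions select the
  representative for which \<open>z(t)\<close> makes sense at each \<open>t\<close>.  The weak derivatives \<open>dt\<close>, \<open>d\<close>, \<open>dd\<close> are
  taken in space-time.\<close>

definition adjoint_solution ::
  "real \<Rightarrow> real \<Rightarrow> complex mat \<Rightarrow> real \<Rightarrow> (nat \<Rightarrow> real \<times> real \<Rightarrow> complex) \<Rightarrow>
   (nat \<Rightarrow> real \<times> real \<times> real \<Rightarrow> complex) \<Rightarrow> bool" where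
  "adjoint_solution X1 X2 A \<tau> \<zeta> z \<longleftrightarrow>
     (\<forall>i<dim_row A. \<forall>t\<in>{0..\<tau>}. (\<lambda>x. z i (t, x)) \<in> H10 (rectangle X1 X2)) \<and>
     (\<forall>i<dim_row A. \<forall>t\<in>{0..\<tau>}.
        ((\<lambda>s. L2norm (lborel_on (rectangle X1 X2)) (\<lambda>x. z i (s, x) - z i (t, x))) \<longlongrightarrow> 0)
          (at t within {0..\<tau>})) \<and>
     (\<forall>i<dim_row A. AE x in lborel_on (rectangle X1 X2). z i (\<tau>, x) = \<zeta> i x) \<and>
     (\<exists>dt d dd. \<forall>i<dim_row A.
        is_weak_deriv (cylinder X1 X2 \<tau>) (1, 0) (z i) (dt i) \<and>
        (\<forall>b\<in>Basis. is_weak_deriv (cylinder X1 X2 \<tau>) (0, b) (z i) (d i b) \<and>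
           (\<forall>c\<in>Basis. is_weak_deriv (cylinder X1 X2 \<tau>) (0, c) (d i b) (dd i b c))) \<and>
        (AE p in lborel_on (cylinder X1 X2 \<tau>).
           - dt i p = (\<Sum>b\<in>Basis. dd i b b p) +
             vec_index (mat_adjoint A *\<^sub>v vec (dim_row A) (\<lambda>j. z j p)) i))"

text \<open>\<open>q\<close> is the normal derivative of \<open>z\<close> on \<open>(0,\<tau>) \<times> \<partial>\<Omega>\<close>.\<close>

definition has_lateral_normal_deriv ::
  "nat \<Rightarrow> real \<Rightarrow> real \<Rightarrow> real \<Rightarrow> (nat \<Rightarrow> real \<times> real \<times> real \<Rightarrow> complex) \<Rightarrow>
   (nat \<Rightarrow> real \<times> real \<times> real \<Rightarrow> complex) \<Rightarrow> bool" where
  "has_lateral_normal_deriv n X1 X2 \<tau> z q \<longleftrightarrow>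
     (\<forall>i<n. square_integrable (boundary_cylinder_measure X1 X2 \<tau>) (q i) \<and>
        (AE t in lborel_on {0<..<\<tau>}.
           has_normal_deriv X1 X2 (\<lambda>x. z i (t, x)) (\<lambda>x. q i (t, x))))"

section \<open>The controlled system\<close>

text \<open>Solution by transposition of \<open>\<partial>\<^sub>t y = \<Delta> y + A y\<close>, \<open>y = 1\<^sub>\<gamma> B g\<close> on \<open>\<partial>\<Omega>\<close>, \<open>y(0) = y\<^sub>0\<close>, in the class
  \<open>C([0,T]; H\<^sup>-\<^sup>1(\<Omega>)\<^sup>n) \<inter> L\<^sup>2(0,T; L\<^sup>2(\<Omega>)\<^sup>n)\<close>.\<close>

definition transposition_solution ::
  "real \<Rightarrow> real \<Rightarrow> (real \<times> real) set \<Rightarrow> complex mat \<Rightarrow> complex mat \<Rightarrow> real \<Rightarrow>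
   (nat \<Rightarrow> (real \<times> real \<Rightarrow> complex) \<Rightarrow> complex) \<Rightarrow>
   (nat \<Rightarrow> real \<times> real \<times> real \<Rightarrow> complex) \<Rightarrow>
   (real \<Rightarrow> nat \<Rightarrow> (real \<times> real \<Rightarrow> complex) \<Rightarrow> complex) \<Rightarrow> bool" where
  "transposition_solution X1 X2 \<gamma> A B T y0 g y \<longleftrightarrow>
     (\<forall>t\<in>{0..T}. \<forall>i<dim_row A. y t i \<in> Hm1 (rectangle X1 X2)) \<and>
     (\<forall>t\<in>{0..T}.
        ((\<lambda>s. Hm1_norm_vec (dim_row A) (rectangle X1 X2) (\<lambda>i \<zeta>. y s i \<zeta> - y t i \<zeta>)) \<longlongrightarrow> 0)
          (at t within {0..T})) \<and>
     (\<exists>u. \<forall>i<dim_row A. square_integrable (lborel_on (cylinder X1 X2 T)) (u i) \<and>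
        (AE t in lborel_on {0<..<T}. \<forall>\<zeta>\<in>H10 (rectangle X1 X2).
           y t i \<zeta> = (\<integral>x. u i (t, x) * cnj (\<zeta> x) \<partial>lborel_on (rectangle X1 X2)))) \<and>
     (\<forall>\<tau>\<in>{0..T}. \<forall>\<zeta> z q.
        (\<forall>i<dim_row A. \<zeta> i \<in> H10 (rectangle X1 X2)) \<longrightarrow>
        adjoint_solution X1 X2 A \<tau> \<zeta> z \<longrightarrow>
        has_lateral_normal_deriv (dim_row A) X1 X2 \<tau> z q \<longrightarrow>
        (\<Sum>i<dim_row A. y \<tau> i (\<zeta> i)) - (\<Sum>i<dim_row A. y0 i (\<lambda>x. z i (0, x))) =
        - (\<integral>p. indicator \<gamma> (snd p) *\<^sub>R
              ((B *\<^sub>v vec (dim_col B) (\<lambda>j. g j p)) \<bullet>c vec (dim_row A) (\<lambda>i. q i p))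
            \<partial>boundary_cylinder_measure X1 X2 \<tau>))"

definition approx_controllable_at ::
  "real \<Rightarrow> real \<Rightarrow> (real \<times> real) set \<Rightarrow> complex mat \<Rightarrow> complex mat \<Rightarrow> real \<Rightarrow> bool" where
  "approx_controllable_at X1 X2 \<gamma> A B T \<longleftrightarrow>
     (\<forall>y0 y1. \<forall>\<epsilon>>0.
        (\<forall>i<dim_row A. y0 i \<in> Hm1 (rectangle X1 X2) \<and> y1 i \<in> Hm1 (rectangle X1 X2)) \<longrightarrow>
        (\<exists>g y. (\<forall>j<dim_col B. square_integrable (boundary_cylinder_measure X1 X2 T) (g j)) \<and>
           transposition_solution X1 X2 \<gamma> A B T y0 g y \<and>
           Hm1_norm_vec (dim_row A) (rectangle X1 X2) (\<lambda>i \<zeta>. y T i \<zeta> - y1 i \<zeta>) \<le> \<epsilon>))"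

definition approx_controllable ::
  "real \<Rightarrow> real \<Rightarrow> (real \<times> real) set \<Rightarrow> complex mat \<Rightarrow> complex mat \<Rightarrow> bool" where
  "approx_controllable X1 X2 \<gamma> A B \<longleftrightarrow> (\<forall>T>0. approx_controllable_at X1 X2 \<gamma> A B T)"

end

theory Submission
  imports Defs "HOL-Real_Asymp.Real_Asymp"
begin

text \<open>Take \<open>\<Omega> = (0, \<pi>) \<times> (0, \<pi> / 2)\<close>, let \<open>A\<close> be diagonal with the distinct entries \<open>p\<^sup>2 + 4 q\<^sup>2\<close>
  (\<open>p \<in> {1, 2}\<close>, \<open>q \<ge> 1\<close>) and let \<open>B\<close> be the column of ones.  The Dirichlet eigenfunctions
  \<open>sin (p x\<^sub>1) sin (2 q x\<^sub>2)\<close>, placed in the matching components, are stationary adjoint states.  On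
  each of the two sides forming \<open>\<gamma>\<close> their normal derivatives depend, up to a factor, on only one of the
  two indices, so the four with \<open>p, q \<in> {1, 2}\<close> can be combined so that \<open>B\<^sup>*\<close> of the normal
  derivative vanishes on all of \<open>\<gamma>\<close>.  Pairing with this adjoint state is then not affected by the
  control.\<close>

section \<open>Smooth functions\<close>

text \<open>The entries of \<open>A\<close> are the Dirichlet eigenvalues of the chosen modes, so in
  every component the reaction term cancels the Laplacian. All modes then share one time behaviour,
  none, and a linear relation between their normal derivatives holds at all times instead of one.
  The coefficients of the four modes form a product a_p b_q: the side x1 = 0 sees the factor p and
  the side x2 = pi/2 the factor 2 q cos (q pi), so each side imposes one linear condition on one
  vector of length two, which has a nonzero solution. Two values of p and two of q give four
  components, whence n >= 4. The sides pi and pi/2 keep the eigenvalues distinct; on a square of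
  side pi the modes (1, 2) and (2, 1) would share the value 5, and a single column \<open>B\<close>
  would violate the kernel condition. The obstacle is that the definitions speak of weak
  derivatives, closures of test functions and traces, and the explicit sines have to be placed in
  these classes: H^1_0 by cutoffs built from exp (-1/t), weak derivatives by integration by parts,
  traces by constant sequences.\<close>

lemma cont_diff_SucI:
  assumes "\<And>x. (f has_derivative f' x) (at x)" and "\<And>v. cont_diff k (\<lambda>x. f' x v)"
  shows "cont_diff (Suc k) f"
  using assms frechet_derivative_at[OF assms(1)]
  by (auto simp: differentiable_def intro: arg_cong[where f="cont_diff k", THEN iffD1, rotated])

lemma cont_diff_SucD: "cont_diff (Suc k) f \<Longrightarrow> cont_diff k f"
proof (induction k arbitrary: f)
  case 0
  then show ?case
    by (auto intro!: differentiable_imp_continuous_on simp: differentiable_on_def differentiable_at_withinI)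
qed auto

lemma cont_diff_derivative:
  "cont_diff (Suc k) f \<Longrightarrow> (f has_derivative frechet_derivative f (at x)) (at x)"
  by (auto simp: frechet_derivative_works)

lemma cont_diff_add:
  "cont_diff k f \<Longrightarrow> cont_diff k g \<Longrightarrow> cont_diff k (\<lambda>x. f x + g x)"
proof (induction k arbitrary: f g)
  case 0
  then show ?case by (auto intro: continuous_intros)
next
  case (Suc k)
  show ?case
    by (rule cont_diff_SucI[OF has_derivative_add[OF Suc.prems[THEN cont_diff_derivative]]])
       (use Suc in auto)
qed

lemma cont_diff_mult:
  "cont_diff k f \<Longrightarrow> cont_diff k g \<Longrightarrow> cont_diff k (\<lambda>x. f x * g x)"
proof (induction k arbitrary: f g)
  case 0
  then show ?case by (auto intro: continuous_intros)
next
  case (Suc k)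
  show ?case
    by (rule cont_diff_SucI[OF has_derivative_mult[OF Suc.prems[THEN cont_diff_derivative]]])
       (intro cont_diff_add Suc.IH; use Suc.prems cont_diff_SucD in auto)
qed

lemma cont_diff_const: "cont_diff k (\<lambda>x. c)"
proof (induction k arbitrary: c)
  case (Suc k)
  show ?case by (rule cont_diff_SucI[OF has_derivative_const]) (rule Suc.IH)
qed auto

lemma smooth_fun_mult: "smooth_fun f \<Longrightarrow> smooth_fun g \<Longrightarrow> smooth_fun (\<lambda>x. f x * g x)"
  by (simp add: smooth_fun_def cont_diff_mult)

lemma smooth_fun_const: "smooth_fun (\<lambda>x. c)"
  by (simp add: smooth_fun_def cont_diff_const)

lemma smooth_fun_derivative:
  "smooth_fun f \<Longrightarrow> (f has_derivative frechet_derivative f (at x)) (at x)"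
  by (meson cont_diff_derivative smooth_fun_def)

lemma smooth_fun_frechet_derivative:
  "smooth_fun f \<Longrightarrow> smooth_fun (\<lambda>x. frechet_derivative f (at x) v)"
  unfolding smooth_fun_def by (metis cont_diff.simps(2))

lemma smooth_fun_continuous_on: "smooth_fun f \<Longrightarrow> continuous_on S f"
  by (meson cont_diff.simps(1) continuous_on_subset smooth_fun_def subset_UNIV)

text \<open>The hypothesis supplies all derivatives of the profile \<open>h 0\<close> at once as a
  sequence. Differentiating along \<open>v\<close> turns \<open>h j\<close> into the constant
  \<open>l v\<close> times \<open>h (Suc j)\<close>, so the induction on the order of smoothness
  runs over all \<open>j\<close> simultaneously.\<close>

lemma smooth_fun_affine:
  fixes l :: "'a::euclidean_space \<Rightarrow> real"
  assumes h: "\<And>j t. (h j has_real_derivative h (Suc j) t) (at t)" and l: "bounded_linear l"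
  shows "smooth_fun (\<lambda>x. complex_of_real (h 0 (l x + c)))"
proof -
  have "cont_diff k (\<lambda>x. complex_of_real (h j (l x + c)))" for k j
  proof (induction k arbitrary: j)
    case 0
    have "isCont (h j) t" for t
      using h by (rule DERIV_isCont)
    then have "continuous_on UNIV (h j)"
      by (simp add: continuous_at_imp_continuous_on)
    then have "continuous_on UNIV (\<lambda>x. h j (l x + c))"
      by (rule continuous_on_compose2) (intro continuous_on_add linear_continuous_on continuous_on_const l, simp)
    then show ?case
      unfolding cont_diff.simps by (rule continuous_on_of_real)
  next
    case (Suc k)
    show ?case
    proof (rule cont_diff_SucI)
      fix x
      have "((\<lambda>x. l x + c) has_derivative l) (at x)"
        by (auto intro!: derivative_eq_intros bounded_linear_imp_has_derivative l)
      then have "((\<lambda>x. h j (l x + c)) has_derivative (\<lambda>v. l v * h (Suc j) (l x + c))) (at x)"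
        using has_derivative_compose[OF _ h[of j, unfolded has_field_derivative_def]]
        by (simp add: mult.commute)
      then show "((\<lambda>x. complex_of_real (h j (l x + c))) has_derivative
          (\<lambda>v. complex_of_real (l v) * complex_of_real (h (Suc j) (l x + c)))) (at x)"
        by (auto dest: has_derivative_of_real)
    qed (intro cont_diff_mult cont_diff_const Suc.IH)
  qed
  then show ?thesis by (simp add: smooth_fun_def)
qed

subsection \<open>A flat function\<close>

text \<open>Polynomials in 1/t times exp (-1/t) form a class closed under differentiation, which is
  why the polynomial is a parameter; \<open>flat 1\<close> is the standard smooth function vanishing
  to infinite order at 0.\<close>

definition flat :: "real poly \<Rightarrow> real \<Rightarrow> real" where
  "flat P t = (if t > 0 then poly P (1 / t) * exp (- (1 / t)) else 0)"

lemma tendsto_poly_exp_neg: "((\<lambda>u::real. poly P u * exp (- u)) \<longlongrightarrow> 0) at_top"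
proof -
  have "((\<lambda>u. \<Sum>i\<le>degree P. coeff P i * (u ^ i / exp u)) \<longlongrightarrow> (\<Sum>i\<le>degree P. coeff P i * 0)) at_top"
    by (intro tendsto_intros tendsto_power_div_exp_0)
  then show ?thesis
    by (simp add: poly_altdef sum_distrib_right exp_minus divide_inverse mult.assoc)
qed

text \<open>With u = 1/t, the derivative of P(u) exp (-u) in t is u^2 (P(u) - P'(u)) exp (-u), and
  \<open>[:0, 0, 1:]\<close> is the polynomial X^2. At t = 0 the two one-sided difference quotients
  are treated separately.\<close>

lemma flat_has_derivative:
  "(flat P has_real_derivative flat ([:0, 0, 1:] * (P - pderiv P)) t) (at t)"
proof -
  let ?Q = "[:0, 0, 1:] * (P - pderiv P)"
  consider "t < 0" | "t > 0" | "t = 0" by linarith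
  then show ?thesis
  proof cases
    case 1
    have "eventually (\<lambda>s. flat P s = 0) (nhds t)"
      using 1 by (auto simp: flat_def eventually_nhds intro!: exI[of _ "{..<0}"])
    then show ?thesis
      using 1 by (subst DERIV_cong_ev[OF refl _ refl]) (auto simp: flat_def)
  next
    case 2
    have "((\<lambda>s. poly P (1 / s) * exp (- (1 / s))) has_real_derivative
        poly ?Q (1 / t) * exp (- (1 / t))) (at t)"
      using 2 by (auto intro!: derivative_eq_intros poly_DERIV[THEN DERIV_chain2]
          simp: field_simps power2_eq_square)
    moreover have "eventually (\<lambda>s. flat P s = poly P (1 / s) * exp (- (1 / s))) (nhds t)"
      using 2 by (auto simp: flat_def eventually_nhds intro!: exI[of _ "{0<..}"])
    ultimately show ?thesis
      using 2 by (subst DERIV_cong_ev[OF refl _ refl]) (auto simp: flat_def)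
  next
    case 3
    \<comment> \<open>\<open>pCons 0 P\<close> is X times P: the division by s in the difference
      quotient at 0 becomes one more factor 1/s, still beaten by the exponential.\<close>
    have "((\<lambda>s. poly (pCons 0 P) (1 / s) * exp (- (1 / s))) \<longlongrightarrow> 0) (at_right 0)"
      using filterlim_compose[OF tendsto_poly_exp_neg filterlim_inverse_at_top_right, of "pCons 0 P"]
      by (simp add: divide_inverse)
    then have "((\<lambda>s. flat P s / s) \<longlongrightarrow> 0) (at_right 0)"
      by (rule Lim_transform_eventually)
         (auto simp: flat_def eventually_at_right_less intro!: eventually_mono[OF eventually_at_right_less])
    moreover have "((\<lambda>s. flat P s / s) \<longlongrightarrow> 0) (at_left 0)"
      by (rule Lim_transform_eventually[OF tendsto_const])
         (auto simp: flat_def eventually_at_filter)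
    ultimately show ?thesis
      using 3 by (auto simp: flat_def has_field_derivative_iff filterlim_split_at)
  qed
qed

text \<open>\<open>flat (flat_poly j)\<close> is the \<open>j\<close>-th derivative of \<open>flat 1\<close>.\<close>

fun flat_poly :: "nat \<Rightarrow> real poly" where
  "flat_poly 0 = 1"
| "flat_poly (Suc j) = [:0, 0, 1:] * (flat_poly j - pderiv (flat_poly j))"

lemma smooth_fun_flat:
  fixes l :: "'a::euclidean_space \<Rightarrow> real"
  assumes "bounded_linear l"
  shows "smooth_fun (\<lambda>x. complex_of_real (flat 1 (l x + c)))"
  using smooth_fun_affine[where h="\<lambda>j. flat (flat_poly j)", OF _ assms] flat_has_derivative
  by simp

text \<open>The j-th derivative of sine is sine shifted by j quarter periods, so one formula
  provides the whole sequence that \<open>smooth_fun_affine\<close> asks for.\<close>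

lemma smooth_fun_sin:
  fixes l :: "'a::euclidean_space \<Rightarrow> real"
  assumes "bounded_linear l"
  shows "smooth_fun (\<lambda>x. complex_of_real (sin (l x + c)))"
proof -
  have "((\<lambda>t. sin (t + real j * (pi / 2))) has_real_derivative sin (t + real (Suc j) * (pi / 2))) (at t)"
    for j t
  proof -
    have "sin (t + real (Suc j) * (pi / 2)) = sin ((t + real j * (pi / 2)) + pi / 2)"
      by (simp add: algebra_simps add_divide_distrib)
    also have "\<dots> = cos (t + real j * (pi / 2))"
      by (subst sin_add) simp
    finally show ?thesis
      by (auto intro!: derivative_eq_intros)
  qed
  from smooth_fun_affine[where h="\<lambda>j t. sin (t + real j * (pi / 2))", OF this assms]
  show ?thesis by simp
qed

section \<open>Integration by parts\<close>

text \<open>The complement of the closed support is open, so the function vanishes on a whole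
  neighbourhood of such a point, and its derivative with it.\<close>

lemma test_functions_zero:
  assumes "\<phi> \<in> test_functions S" "x \<notin> S"
  shows "\<phi> x = 0" "frechet_derivative \<phi> (at x) = (\<lambda>_. 0)"
proof -
  have x: "x \<in> - closure {x. \<phi> x \<noteq> 0}"
    using assms by (auto simp: test_functions_def)
  have 0: "\<phi> y = 0" if "y \<in> - closure {x. \<phi> x \<noteq> 0}" for y
    using that closure_subset[of "{x. \<phi> x \<noteq> 0}"] by auto
  show "\<phi> x = 0" by (rule 0[OF x])
  have "open (- closure {x. \<phi> x \<noteq> 0})"
    by (rule open_Compl[OF closed_closure])
  then have "(\<phi> has_derivative (\<lambda>_. 0)) (at x)"
    by (rule has_derivative_transform_within_open[OF has_derivative_const _ x 0[symmetric]])
  then show "frechet_derivative \<phi> (at x) = (\<lambda>_. 0)"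
    by (rule frechet_derivative_at[symmetric])
qed

lemma integrable_test_functions:
  assumes "\<phi> \<in> test_functions S"
  shows "integrable lborel \<phi>"
proof -
  have "integrable lborel (\<lambda>x. indicator (closure {x. \<phi> x \<noteq> 0}) x *\<^sub>R \<phi> x)"
    using assms by (intro borel_integrable_compact)
      (auto simp: test_functions_def smooth_fun_continuous_on)
  moreover have "indicator (closure {x. \<phi> x \<noteq> 0}) x *\<^sub>R \<phi> x = \<phi> x" for x
    using closure_subset[of "{x. \<phi> x \<noteq> 0}"] by (auto simp: indicator_def)
  ultimately show ?thesis by simp
qed

lemma test_functionsI:
  fixes f \<phi> :: "'a::euclidean_space \<Rightarrow> complex"
  assumes "\<phi> \<in> test_functions S" "smooth_fun f" "{x. f x \<noteq> 0} \<subseteq> closure {x. \<phi> x \<noteq> 0}"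
  shows "f \<in> test_functions S"
proof -
  have \<phi>: "compact (closure {x. \<phi> x \<noteq> 0})" "closure {x. \<phi> x \<noteq> 0} \<subseteq> S"
    using assms(1) unfolding test_functions_def by auto
  have sub: "closure {x. f x \<noteq> 0} \<subseteq> closure {x. \<phi> x \<noteq> 0}"
    by (rule closure_minimal[OF assms(3) closed_closure])
  have "compact (closure {x. f x \<noteq> 0})"
    using compact_Int_closed[OF \<phi>(1) closed_closure[of "{x. f x \<noteq> 0}"]]
    unfolding Int_absorb1[OF sub] .
  then show ?thesis
    unfolding test_functions_def mem_Collect_eq
    by (intro conjI assms(2) order_trans[OF sub \<phi>(2)])
qed

lemma test_functions_mult:
  assumes "\<phi> \<in> test_functions S" "smooth_fun u"
  shows "(\<lambda>x. u x * \<phi> x) \<in> test_functions S"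
proof (rule test_functionsI[OF assms(1)])
  show "smooth_fun (\<lambda>x. u x * \<phi> x)"
    using assms by (simp add: test_functions_def smooth_fun_mult)
  show "{x. u x * \<phi> x \<noteq> 0} \<subseteq> closure {x. \<phi> x \<noteq> 0}"
    by (rule order_trans[OF _ closure_subset]) auto
qed

lemma test_functions_frechet_derivative:
  assumes "\<phi> \<in> test_functions S"
  shows "(\<lambda>x. frechet_derivative \<phi> (at x) b) \<in> test_functions S"
proof (rule test_functionsI[OF assms])
  show "smooth_fun (\<lambda>x. frechet_derivative \<phi> (at x) b)"
    using assms by (simp add: test_functions_def smooth_fun_frechet_derivative)
  \<comment> \<open>\<open>test_functions\<close> imposes no openness, so a test function may be
    regarded as one on its own closed support; this makes the derivative vanish off the support and
    not just off \<open>S\<close>.\<close>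
  have \<phi>: "\<phi> \<in> test_functions (closure {x. \<phi> x \<noteq> 0})"
    using assms by (simp add: test_functions_def)
  show "{x. frechet_derivative \<phi> (at x) b \<noteq> 0} \<subseteq> closure {x. \<phi> x \<noteq> 0}"
  proof (rule subsetI, rule ccontr)
    fix x assume "x \<in> {x. frechet_derivative \<phi> (at x) b \<noteq> 0}" "x \<notin> closure {x. \<phi> x \<noteq> 0}"
    then show False
      using test_functions_zero(2)[OF \<phi>, of x] by simp
  qed
qed

lemma smooth_fun_directional:
  assumes "smooth_fun f"
  shows "((\<lambda>s. f (x + s *\<^sub>R b)) has_vector_derivative
    frechet_derivative f (at (x + s *\<^sub>R b)) b) (at s)"
proof -
  have "((\<lambda>s. x + s *\<^sub>R b) has_derivative (\<lambda>s. s *\<^sub>R b)) (at s)"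
    using has_derivative_add[OF has_derivative_const
        bounded_linear_imp_has_derivative[OF bounded_linear_scaleR_left]] by simp
  from has_derivative_compose[OF this smooth_fun_derivative[OF assms]]
  have "((\<lambda>s. f (x + s *\<^sub>R b)) has_derivative
      (\<lambda>r. frechet_derivative f (at (x + s *\<^sub>R b)) (r *\<^sub>R b))) (at s)" .
  then show ?thesis
    using linear_scale[OF has_derivative_linear[OF smooth_fun_derivative[OF assms]]]
    by (simp add: has_vector_derivative_def)
qed

lemma has_vector_derivative_tendsto:
  fixes f :: "real \<Rightarrow> complex"
  assumes "(f has_vector_derivative D) (at s)"
  shows "((\<lambda>h. (f (s + h) - f s) / complex_of_real h) \<longlongrightarrow> D) (at 0)"
  using assms
  by (simp add: has_vector_derivative_complex_iff DERIV_def tendsto_complex_iff Re_divide_of_real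
      Im_divide_of_real)

lemma integral_translate:
  fixes f :: "'a::euclidean_space \<Rightarrow> complex"
  assumes "f \<in> borel_measurable borel"
  shows "(\<integral>x. f (x + c) \<partial>lborel) = (\<integral>x. f x \<partial>lborel)"
proof -
  have "(\<integral>x. f x \<partial>lborel) = (\<integral>x. f x \<partial>distr lborel borel ((+) c))"
    by (simp add: lborel_distr_plus)
  also have "\<dots> = (\<integral>x. f (x + c) \<partial>lborel)"
    using assms by (subst integral_distr) (auto simp: add.commute)
  finally show ?thesis ..
qed

lemma integrable_translate:
  fixes f :: "'a::euclidean_space \<Rightarrow> complex"
  assumes "integrable lborel f"
  shows "integrable lborel (\<lambda>x. f (x + c))"
proof -
  have "integrable (distr lborel borel ((+) c)) f"
    using assms by (simp add: lborel_distr_plus)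
  then have "integrable lborel (\<lambda>x. f (c + x))"
    by (subst (asm) integrable_distr_eq) (use assms in auto)
  then show ?thesis by (simp add: add.commute)
qed

text \<open>The difference quotients integrate to 0 by translation invariance, and converge dominatedly.\<close>

lemma integral_frechet_derivative_test:
  fixes f :: "'a::euclidean_space \<Rightarrow> complex"
  assumes f: "f \<in> test_functions S"
  shows "(\<integral>x. frechet_derivative f (at x) b \<partial>lborel) = 0"
proof -
  define K where "K = closure {x. f x \<noteq> 0}"
  \<comment> \<open>All difference quotients along \<open>b\<close> with step at most 1 are
    supported in this compact sum of \<open>K\<close> and a ball; it carries the dominating
    function.\<close>
  define K' where "K' = (\<Union>x\<in>K. \<Union>y\<in>cball 0 (norm b). {x + y})"
  define g where "g = (\<lambda>x. frechet_derivative f (at x) b)"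
  define h where "h = (\<lambda>n. 1 / real (Suc n))"
  define D where "D = (\<lambda>n x. (f (x + h n *\<^sub>R b) - f x) / complex_of_real (h n))"
  have sm: "smooth_fun f" and fK: "f \<in> test_functions K" and K: "compact K"
    using f by (auto simp: test_functions_def K_def)
  have K': "compact K'"
    unfolding K'_def by (intro compact_sums' K compact_cball)
  have int_f: "integrable lborel f"
    by (rule integrable_test_functions[OF f])
  have contg: "continuous_on T g" for T
    unfolding g_def by (intro smooth_fun_continuous_on smooth_fun_frechet_derivative sm)
  have "bounded (g ` K)"
    by (intro compact_imp_bounded compact_continuous_image contg K)
  then obtain C where C: "C > 0" "\<And>x. x \<in> K \<Longrightarrow> norm (g x) \<le> C"
    by (auto simp: bounded_pos)
  have gC: "norm (g x) \<le> C" for x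
    using C test_functions_zero(2)[OF fK, of x] by (cases "x \<in> K") (auto simp: g_def)
  have h: "h n > 0" "h n \<le> 1" for n
    by (auto simp: h_def)
  have D_bound: "norm (D n x) \<le> indicator K' x * C" for n x
  proof (cases "x \<in> K'")
    case True
    \<comment> \<open>Mean value inequality along the segment; \<open>C\<close> bounds the
      derivative everywhere because the derivative vanishes off \<open>K\<close>.\<close>
    have "norm (f (x + h n *\<^sub>R b) - f (x + 0 *\<^sub>R b)) \<le> C * norm (h n - 0)"
    proof (rule differentiable_bound[where S=UNIV and f="\<lambda>s. f (x + s *\<^sub>R b)"])
      show "((\<lambda>s. f (x + s *\<^sub>R b)) has_derivative (\<lambda>r. r *\<^sub>R g (x + s *\<^sub>R b))) (at s within UNIV)" for s
        using smooth_fun_directional[OF sm] by (simp add: has_vector_derivative_def g_def)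
      show "onorm (\<lambda>r. r *\<^sub>R g (x + s *\<^sub>R b)) \<le> C" for s
        by (rule onorm_le) (use gC in \<open>auto intro: mult_left_mono simp: mult.commute[of C]\<close>)
    qed auto
    then show ?thesis
      using True h[of n] by (simp add: D_def norm_divide field_simps)
  next
    case False
    have "x \<notin> K"
      using False unfolding K'_def by force
    moreover have "x + h n *\<^sub>R b \<notin> K"
    proof
      assume *: "x + h n *\<^sub>R b \<in> K"
      have "x = (x + h n *\<^sub>R b) + (- (h n *\<^sub>R b))" "- (h n *\<^sub>R b) \<in> cball 0 (norm b)"
        using h[of n] by (auto intro: mult_left_le_one_le)
      then have "x \<in> K'"
        unfolding K'_def using * by blast
      then show False using False by simp
    qed
    ultimately show ?thesis
      using False test_functions_zero(1)[OF fK] by (simp add: D_def)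
  qed
  have D_int: "(\<integral>x. D n x \<partial>lborel) = 0" for n
    using int_f integrable_translate[OF int_f, of "h n *\<^sub>R b"]
      integral_translate[of f "h n *\<^sub>R b"]
    by (simp add: D_def)
  have "(\<lambda>n. \<integral>x. D n x \<partial>lborel) \<longlonglongrightarrow> (\<integral>x. g x \<partial>lborel)"
  proof (rule integral_dominated_convergence)
    show "integrable lborel (\<lambda>x. indicator K' x * C)"
      using borel_integrable_compact[OF K', of "\<lambda>_. C"] by simp
    show "g \<in> borel_measurable lborel"
      using borel_measurable_continuous_onI[OF contg] by simp
    show "D n \<in> borel_measurable lborel" for n
      using int_f integrable_translate[OF int_f, of "h n *\<^sub>R b"]
      unfolding D_def by auto
    have "h \<longlonglongrightarrow> 0"
      unfolding h_def by (rule LIMSEQ_Suc) (rule lim_1_over_n)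
    then have "filterlim h (at 0) sequentially"
      using h by (auto simp: filterlim_at less_imp_neq[symmetric] intro!: always_eventually)
    note lim = filterlim_compose[OF has_vector_derivative_tendsto[OF smooth_fun_directional[OF sm]] this]
    have "(\<lambda>n. D n x) \<longlonglongrightarrow> g x" for x
      using lim[of x 0 b] by (simp add: D_def g_def)
    then show "AE x in lborel. (\<lambda>n. D n x) \<longlonglongrightarrow> g x" by simp
    show "AE x in lborel. norm (D n x) \<le> indicator K' x * C" for n
      using D_bound by simp
  qed
  then show ?thesis
    using D_int by (simp add: g_def LIMSEQ_const_iff)
qed

lemma continuous_square_integrable:
  fixes u :: "'a::euclidean_space \<Rightarrow> complex"
  assumes u: "continuous_on UNIV u" and S: "open S" "bounded S"
  shows "square_integrable (lborel_on S) u"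
proof -
  have "compact (closure S)" using S by (simp add: compact_closure)
  have c: "continuous_on UNIV (\<lambda>x. (cmod (u x))\<^sup>2)"
    by (intro continuous_intros u)
  have "set_integrable lborel (closure S) (\<lambda>x. (cmod (u x))\<^sup>2)"
    unfolding set_integrable_def
    by (intro borel_integrable_compact \<open>compact (closure S)\<close> continuous_on_subset[OF c]) auto
  then have "set_integrable lborel S (\<lambda>x. (cmod (u x))\<^sup>2)"
    by (rule set_integrable_subset) (use S closure_subset in auto)
  then show ?thesis
    using S borel_measurable_continuous_onI[OF u]
    by (auto simp: square_integrable_def integrable_restrict_space set_integrable_def intro: measurable_restrict_space1)
qed

lemma integral_lborel_on_eq:
  fixes f :: "'a::euclidean_space \<Rightarrow> complex"
  assumes "open S" "\<And>x. x \<notin> S \<Longrightarrow> f x = 0"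
  shows "(\<integral>x. f x \<partial>lborel_on S) = (\<integral>x. f x \<partial>lborel)"
  using assms
  by (subst integral_restrict_space) (auto intro!: Bochner_Integration.integral_cong simp: indicator_def)

text \<open>The product of u with a test function is again a test function, so its directional
  derivative integrates to 0, and the product rule splits that integral into the two sides.\<close>

lemma smooth_is_weak_deriv:
  fixes u :: "'a::euclidean_space \<Rightarrow> complex"
  assumes u: "smooth_fun u" and S: "open S" "bounded S"
  shows "is_weak_deriv S b u (\<lambda>x. frechet_derivative u (at x) b)"
  unfolding is_weak_deriv_def
proof (intro conjI ballI)
  show "square_integrable (lborel_on S) u"
    "square_integrable (lborel_on S) (\<lambda>x. frechet_derivative u (at x) b)"
    using u by (auto intro!: continuous_square_integrable S smooth_fun_continuous_on
        smooth_fun_frechet_derivative)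
  fix \<phi> assume \<phi>: "\<phi> \<in> test_functions S"
  then have \<phi>s: "smooth_fun \<phi>" by (simp add: test_functions_def)
  let ?u' = "\<lambda>x. frechet_derivative u (at x) b" and ?\<phi>' = "\<lambda>x. frechet_derivative \<phi> (at x) b"
  have 1: "(\<lambda>x. u x * ?\<phi>' x) \<in> test_functions S" and 2: "(\<lambda>x. ?u' x * \<phi> x) \<in> test_functions S"
    using \<phi> u by (auto intro!: test_functions_mult test_functions_frechet_derivative
        smooth_fun_frechet_derivative)
  have "((\<lambda>x. u x * \<phi> x) has_derivative
      (\<lambda>v. u x * frechet_derivative \<phi> (at x) v + frechet_derivative u (at x) v * \<phi> x)) (at x)" for x
    by (rule has_derivative_mult[OF smooth_fun_derivative[OF u] smooth_fun_derivative[OF \<phi>s]])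
  then have "frechet_derivative (\<lambda>x. u x * \<phi> x) (at x) b = u x * ?\<phi>' x + ?u' x * \<phi> x" for x
    by (rule arg_cong[where f="\<lambda>d. d b", OF frechet_derivative_at[symmetric]])
  then have "0 = (\<integral>x. u x * ?\<phi>' x + ?u' x * \<phi> x \<partial>lborel)"
    using integral_frechet_derivative_test[OF test_functions_mult[OF \<phi> u], of b] by simp
  also have "\<dots> = (\<integral>x. u x * ?\<phi>' x \<partial>lborel) + (\<integral>x. ?u' x * \<phi> x \<partial>lborel)"
    by (intro Bochner_Integration.integral_add integrable_test_functions[OF 1]
        integrable_test_functions[OF 2])
  finally have "(\<integral>x. u x * ?\<phi>' x \<partial>lborel) = - (\<integral>x. ?u' x * \<phi> x \<partial>lborel)"
    by (simp add: eq_neg_iff_add_eq_0)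
  then show "(\<integral>x. u x * ?\<phi>' x \<partial>lborel_on S) = - (\<integral>x. ?u' x * \<phi> x \<partial>lborel_on S)"
    using test_functions_zero[OF \<phi>] S by (simp add: integral_lborel_on_eq)
qed

section \<open>Membership in \<open>H\<^sup>1\<^sub>0\<close> of a rectangle\<close>

lemma finite_measure_lborel_on:
  fixes S :: "'a::euclidean_space set"
  assumes "open S" "bounded S"
  shows "finite_measure (lborel_on S)"
proof
  have "emeasure (lborel_on S) (space (lborel_on S)) = emeasure lborel S"
    using assms by (simp add: emeasure_restrict_space space_restrict_space)
  then show "emeasure (lborel_on S) (space (lborel_on S)) \<noteq> \<infinity>"
    using emeasure_bounded_finite[OF assms(2)] by simp
qed

text \<open>Bounded convergence: \<open>S\<close> has finite measure, so the constant
  \<open>C\<close> squared dominates the squared moduli.\<close>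

lemma L2norm_tendsto_0:
  fixes F :: "nat \<Rightarrow> 'a::euclidean_space \<Rightarrow> complex"
  assumes S: "open S" "bounded S" and F: "\<And>k. F k \<in> borel_measurable borel"
    and C: "\<And>k x. x \<in> S \<Longrightarrow> cmod (F k x) \<le> C"
    and lim: "\<And>x. x \<in> S \<Longrightarrow> (\<lambda>k. F k x) \<longlonglongrightarrow> 0"
  shows "(\<lambda>k. L2norm (lborel_on S) (F k)) \<longlonglongrightarrow> 0"
proof -
  interpret finite_measure "lborel_on S"
    by (rule finite_measure_lborel_on[OF S])
  have sp: "space (lborel_on S) = S"
    by (simp add: space_restrict_space)
  have "(\<lambda>k. \<integral>x. (cmod (F k x))\<^sup>2 \<partial>lborel_on S) \<longlonglongrightarrow> (\<integral>x. 0 \<partial>lborel_on S)"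
  proof (rule integral_dominated_convergence)
    show "(\<lambda>x. (cmod (F k x))\<^sup>2) \<in> borel_measurable (lborel_on S)" for k
      using F[of k] by (intro measurable_restrict_space1) simp
    show "AE x in lborel_on S. (\<lambda>k. (cmod (F k x))\<^sup>2) \<longlonglongrightarrow> 0"
    proof (rule AE_I2)
      fix x assume "x \<in> space (lborel_on S)"
      then have "(\<lambda>k. (cmod (F k x))\<^sup>2) \<longlonglongrightarrow> (cmod 0)\<^sup>2"
        by (intro tendsto_intros lim) (simp add: sp)
      then show "(\<lambda>k. (cmod (F k x))\<^sup>2) \<longlonglongrightarrow> 0" by simp
    qed
    show "AE x in lborel_on S. norm ((cmod (F k x))\<^sup>2) \<le> C\<^sup>2" for k
      using C by (intro AE_I2) (simp add: sp power_mono)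
  qed auto
  then have "(\<lambda>k. L2norm (lborel_on S) (F k)) \<longlonglongrightarrow> sqrt 0"
    unfolding L2norm_def by (intro tendsto_real_sqrt) simp
  then show ?thesis by simp
qed

section \<open>Cutoff functions on an interval and the size of their derivatives\<close>

lemma flat_1_bounds: "0 \<le> flat 1 t" "flat 1 t \<le> 1"
  by (auto simp: flat_def)

lemma flat_1_has_derivative: "(flat 1 has_real_derivative flat [:0, 0, 1:] t) (at t)"
  using flat_has_derivative[of 1 t] by simp

text \<open>\<open>flat [:0, 0, 1:]\<close> is the derivative of \<open>flat 1\<close>. The cutoffs
  evaluate it at t = K x - 1, so t + 1 = K x is the distance to the end in units of the cutoff
  width. With u = 1/t the claim reads u + u^2 <= 2 exp u, a consequence of the quadratic Taylor
  bound.\<close>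

lemma flat_X2_bound: "\<bar>(t + 1) * flat [:0, 0, 1:] t\<bar> \<le> 2"
proof (cases "t > 0")
  case True
  define u where "u = 1 / t"
  have u: "u > 0" "t = 1 / u" using True by (auto simp: u_def)
  have "flat [:0, 0, 1:] t = u\<^sup>2 * exp (- u)"
    using True by (simp add: flat_def u_def power2_eq_square)
  then have "(t + 1) * flat [:0, 0, 1:] t = (1 / u + 1) * (u\<^sup>2 * exp (- u))"
    using u(2) by simp
  also have "\<dots> = (u + u\<^sup>2) / exp u"
    using u(1) by (simp add: exp_minus field_simps power2_eq_square)
  also have "\<dots> \<le> 2"
    using exp_lower_Taylor_quadratic[of u] u by (simp add: field_simps)
  finally show ?thesis
    using True by (simp add: flat_def)
qed (simp add: flat_def)

lemma flat_1_tendsto: "(flat 1 \<longlongrightarrow> 1) at_top"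
proof -
  have "((\<lambda>t::real. exp (- (1 / t))) \<longlongrightarrow> 1) at_top"
    by real_asymp
  then show ?thesis
    by (rule Lim_transform_eventually)
       (use eventually_gt_at_top[of "0::real"] in eventually_elim, simp add: flat_def)
qed

lemma flat_X2_tendsto: "((\<lambda>t. (t + 1) * flat [:0, 0, 1:] t) \<longlongrightarrow> 0) at_top"
proof -
  have "((\<lambda>t::real. (t + 1) * ((1 / t)\<^sup>2 * exp (- (1 / t)))) \<longlongrightarrow> 0) at_top"
    by real_asymp
  then show ?thesis
    by (rule Lim_transform_eventually)
       (use eventually_gt_at_top[of "0::real"] in eventually_elim, simp add: flat_def power2_eq_square)
qed

text \<open>The shift by 1 keeps the support at distance 1/(k+1) from both ends. Inside the interval
  the values tend to 1 without ever reaching it, which suffices for dominated convergence.\<close>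

definition cutoff :: "real \<Rightarrow> nat \<Rightarrow> real \<Rightarrow> real" where
  "cutoff L k x = flat 1 (real (Suc k) * x - 1) * flat 1 (real (Suc k) * (L - x) - 1)"

definition cutoff' :: "real \<Rightarrow> nat \<Rightarrow> real \<Rightarrow> real" where
  "cutoff' L k x =
     real (Suc k) * flat [:0, 0, 1:] (real (Suc k) * x - 1) * flat 1 (real (Suc k) * (L - x) - 1) -
     flat 1 (real (Suc k) * x - 1) * (real (Suc k) * flat [:0, 0, 1:] (real (Suc k) * (L - x) - 1))"

lemma cutoff_has_derivative: "(cutoff L k has_real_derivative cutoff' L k x) (at x)"
  unfolding cutoff_def[abs_def] cutoff'_def
  by (auto intro!: derivative_eq_intros DERIV_chain2[OF flat_1_has_derivative]
      simp: algebra_simps)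

lemma cutoff_nonzero:
  assumes "cutoff L k x \<noteq> 0"
  shows "1 / real (Suc k) \<le> x" "x \<le> L - 1 / real (Suc k)"
proof -
  have "real (Suc k) * x - 1 > 0" "real (Suc k) * (L - x) - 1 > 0"
    using assms by (auto simp: cutoff_def flat_def split: if_splits)
  then show "1 / real (Suc k) \<le> x" "x \<le> L - 1 / real (Suc k)"
    by (auto simp: field_simps)
qed

lemma cutoff_bound: "\<bar>cutoff L k x\<bar> \<le> 1"
  using flat_1_bounds by (auto simp: cutoff_def abs_mult intro!: mult_le_one)

lemma filterlim_scaled_at_top:
  assumes "x > 0"
  shows "filterlim (\<lambda>k. real (Suc k) * x - 1) at_top sequentially"
proof -
  have "filterlim (\<lambda>k. x * real (Suc k)) at_top sequentially"
    using assms
    by (intro filterlim_tendsto_pos_mult_at_top[OF tendsto_const] filterlim_compose[OF filterlim_real_sequentially] filterlim_Suc)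
  then have "filterlim (\<lambda>k. -1 + x * real (Suc k)) at_top sequentially"
    by (rule filterlim_tendsto_add_at_top[OF tendsto_const])
  then show ?thesis by (simp add: mult.commute)
qed

lemma cutoff_tendsto:
  assumes "0 < x" "x < L"
  shows "(\<lambda>k. cutoff L k x) \<longlonglongrightarrow> 1"
proof -
  have "(\<lambda>k. cutoff L k x) \<longlonglongrightarrow> 1 * 1"
    unfolding cutoff_def using assms
    by (intro tendsto_mult filterlim_compose[OF flat_1_tendsto] filterlim_scaled_at_top) auto
  then show ?thesis by simp
qed

text \<open>The derivative of the cutoff blows up only where a function vanishing at both ends is small.\<close>

lemma cutoff'_mult_bound:
  assumes "0 < x" "x < L" "\<bar>s\<bar> \<le> M * x" "\<bar>s\<bar> \<le> M * (L - x)"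
  shows "\<bar>s * cutoff' L k x\<bar> \<le> 4 * M"
    and "\<bar>s * cutoff' L k x\<bar> \<le> M * \<bar>real (Suc k) * x * flat [:0, 0, 1:] (real (Suc k) * x - 1)\<bar> +
      M * \<bar>real (Suc k) * (L - x) * flat [:0, 0, 1:] (real (Suc k) * (L - x) - 1)\<bar>"
proof -
  let ?K = "real (Suc k)" and ?d = "flat [:0, 0, 1:]"
  have M: "0 \<le> M"
    using assms(1,3) abs_ge_zero[of s] by (metis order_trans zero_le_mult_iff not_le)
  \<comment> \<open>The bound |s| <= M y trades the factor K of the derivative for K y, the
    combination controlled by \<open>flat_X2_bound\<close>; \<open>r\<close> stands for the other
    factor of the cutoff, which lies in [0, 1].\<close>
  have 1: "\<bar>s * (?K * ?d (?K * y - 1) * r)\<bar> \<le> M * \<bar>?K * y * ?d (?K * y - 1)\<bar>"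
    if "0 < y" "\<bar>s\<bar> \<le> M * y" "0 \<le> r" "r \<le> 1" for y r
  proof -
    have "\<bar>s\<bar> * \<bar>?K * ?d (?K * y - 1)\<bar> * \<bar>r\<bar> \<le> (M * y) * \<bar>?K * ?d (?K * y - 1)\<bar> * 1"
      using that M by (intro mult_mono) auto
    then show ?thesis
      using that by (simp add: abs_mult mult_ac)
  qed
  have "\<bar>s * cutoff' L k x\<bar> \<le>
      \<bar>s * (?K * ?d (?K * x - 1) * flat 1 (?K * (L - x) - 1))\<bar> +
      \<bar>s * (?K * ?d (?K * (L - x) - 1) * flat 1 (?K * x - 1))\<bar>"
    unfolding cutoff'_def right_diff_distrib
    by (rule order_trans[OF abs_triangle_ineq4]) (simp add: mult_ac)
  also have "\<dots> \<le> M * \<bar>?K * x * ?d (?K * x - 1)\<bar> + M * \<bar>?K * (L - x) * ?d (?K * (L - x) - 1)\<bar>"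
    using assms flat_1_bounds by (intro add_mono 1) auto
  finally show 2: "\<bar>s * cutoff' L k x\<bar> \<le>
    M * \<bar>?K * x * ?d (?K * x - 1)\<bar> + M * \<bar>?K * (L - x) * ?d (?K * (L - x) - 1)\<bar>" .
  also have "\<dots> \<le> M * 2 + M * 2"
    using flat_X2_bound[of "?K * x - 1"] flat_X2_bound[of "?K * (L - x) - 1"] M
    by (intro add_mono mult_left_mono) auto
  finally show "\<bar>s * cutoff' L k x\<bar> \<le> 4 * M" by simp
qed

lemma cutoff'_mult_tendsto:
  assumes "0 < x" "x < L" "\<bar>s\<bar> \<le> M * x" "\<bar>s\<bar> \<le> M * (L - x)"
  shows "(\<lambda>k. s * cutoff' L k x) \<longlonglongrightarrow> 0"
proof -
  have lim: "(\<lambda>k. real (Suc k) * y * flat [:0, 0, 1:] (real (Suc k) * y - 1)) \<longlonglongrightarrow> 0" if "0 < y" for y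
    using filterlim_compose[OF flat_X2_tendsto filterlim_scaled_at_top[OF that]] by simp
  have "(\<lambda>k. M * \<bar>real (Suc k) * x * flat [:0, 0, 1:] (real (Suc k) * x - 1)\<bar> +
      M * \<bar>real (Suc k) * (L - x) * flat [:0, 0, 1:] (real (Suc k) * (L - x) - 1)\<bar>) \<longlonglongrightarrow>
      M * \<bar>0\<bar> + M * \<bar>0\<bar>"
    using assms by (intro tendsto_intros lim) auto
  then have "(\<lambda>k. M * \<bar>real (Suc k) * x * flat [:0, 0, 1:] (real (Suc k) * x - 1)\<bar> +
      M * \<bar>real (Suc k) * (L - x) * flat [:0, 0, 1:] (real (Suc k) * (L - x) - 1)\<bar>) \<longlonglongrightarrow> 0"
    by simp
  then show ?thesis
    by (rule Lim_null_comparison[rotated])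
       (use cutoff'_mult_bound(2)[OF assms] in \<open>simp add: always_eventually\<close>)
qed

section \<open>Cut-off sines in one variable\<close>

lemma abs_sin_le_dist_zero:
  fixes a c x :: real
  assumes "sin (a * c) = 0"
  shows "\<bar>sin (a * x)\<bar> \<le> \<bar>a\<bar> * \<bar>x - c\<bar>"
proof -
  have "sin (a * x) = sin (a * (x - c)) * cos (a * c)"
    using assms sin_add[of "a * (x - c)" "a * c"] by (simp add: algebra_simps)
  then have "\<bar>sin (a * x)\<bar> \<le> \<bar>sin (a * (x - c))\<bar>"
    by (simp add: abs_mult mult_left_le)
  also have "\<dots> \<le> \<bar>a * (x - c)\<bar>"
    by (rule abs_sin_x_le_abs_x)
  finally show ?thesis by (simp add: abs_mult)
qed

definition truncated_sin :: "real \<Rightarrow> real \<Rightarrow> nat \<Rightarrow> real \<Rightarrow> real" where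
  "truncated_sin a L k x = sin (a * x) * cutoff L k x"

definition truncated_sin' :: "real \<Rightarrow> real \<Rightarrow> nat \<Rightarrow> real \<Rightarrow> real" where
  "truncated_sin' a L k x = a * cos (a * x) * cutoff L k x + sin (a * x) * cutoff' L k x"

lemma truncated_sin_has_derivative:
  "(truncated_sin a L k has_real_derivative truncated_sin' a L k x) (at x)"
  unfolding truncated_sin_def[abs_def] truncated_sin'_def
  by (auto intro!: derivative_eq_intros DERIV_chain2[OF cutoff_has_derivative])

text \<open>The 5 is 1 from the differentiated sine plus 4 from the differentiated cutoff, whose
  growing slope is absorbed by the zeros of the sine at the two ends.\<close>

lemma truncated_sin_props:
  assumes "sin (a * L) = 0" "0 < x" "x < L"
  shows "\<bar>truncated_sin a L k x\<bar> \<le> 1" "\<bar>truncated_sin' a L k x\<bar> \<le> 5 * \<bar>a\<bar>"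
    "(\<lambda>k. truncated_sin a L k x) \<longlonglongrightarrow> sin (a * x)"
    "(\<lambda>k. truncated_sin' a L k x) \<longlonglongrightarrow> a * cos (a * x)"
proof -
  \<comment> \<open>The zeros of the sine at 0 and at L give linear smallness at both ends with
    constant M = |a|, as the cutoff estimates require.\<close>
  have s: "\<bar>sin (a * x)\<bar> \<le> \<bar>a\<bar> * x" "\<bar>sin (a * x)\<bar> \<le> \<bar>a\<bar> * (L - x)"
    using abs_sin_le_dist_zero[of a 0 x] abs_sin_le_dist_zero[OF assms(1), of x] assms(2,3) by auto
  show "\<bar>truncated_sin a L k x\<bar> \<le> 1"
    using cutoff_bound by (auto simp: truncated_sin_def abs_mult intro!: mult_le_one)
  have "\<bar>cos (a * x)\<bar> * \<bar>cutoff L k x\<bar> \<le> 1"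
    using cutoff_bound by (intro mult_le_one) auto
  then have "\<bar>a * cos (a * x) * cutoff L k x\<bar> \<le> \<bar>a\<bar>"
    using mult_left_mono[of _ 1 "\<bar>a\<bar>"] by (auto simp: abs_mult mult.assoc)
  then show "\<bar>truncated_sin' a L k x\<bar> \<le> 5 * \<bar>a\<bar>"
    using cutoff'_mult_bound(1)[OF assms(2,3) s, of k] unfolding truncated_sin'_def by linarith
  have "(\<lambda>k. truncated_sin a L k x) \<longlonglongrightarrow> sin (a * x) * 1"
    unfolding truncated_sin_def by (intro tendsto_intros cutoff_tendsto assms)
  then show "(\<lambda>k. truncated_sin a L k x) \<longlonglongrightarrow> sin (a * x)" by simp
  have "(\<lambda>k. truncated_sin' a L k x) \<longlonglongrightarrow> a * cos (a * x) * 1 + 0"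
    unfolding truncated_sin'_def
    by (intro tendsto_intros cutoff_tendsto cutoff'_mult_tendsto[OF assms(2,3) s] assms)
  then show "(\<lambda>k. truncated_sin' a L k x) \<longlonglongrightarrow> a * cos (a * x)" by simp
qed

section \<open>Products of sines in two variables\<close>

lemma smooth_fun_cutoff:
  fixes l :: "'a::euclidean_space \<Rightarrow> real"
  assumes l: "bounded_linear l"
  shows "smooth_fun (\<lambda>p. complex_of_real (cutoff L k (l p)))"
proof -
  have b: "bounded_linear (\<lambda>p. c * l p)" for c
    by (rule bounded_linear_compose[OF bounded_linear_mult_right l])
  have "smooth_fun (\<lambda>p. complex_of_real (flat 1 (real (Suc k) * l p + (- 1))) *
      complex_of_real (flat 1 (- real (Suc k) * l p + (real (Suc k) * L - 1))))"
    by (intro smooth_fun_mult smooth_fun_flat b)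
  also have "(\<lambda>p. complex_of_real (flat 1 (real (Suc k) * l p + (- 1))) *
      complex_of_real (flat 1 (- real (Suc k) * l p + (real (Suc k) * L - 1)))) =
      (\<lambda>p. complex_of_real (cutoff L k (l p)))"
    by (auto simp: cutoff_def fun_eq_iff algebra_simps)
  finally show ?thesis .
qed

lemma smooth_fun_sin_mult:
  fixes l :: "'a::euclidean_space \<Rightarrow> real"
  assumes l: "bounded_linear l"
  shows "smooth_fun (\<lambda>p. complex_of_real (sin (a * l p)))"
  using smooth_fun_sin[OF bounded_linear_compose[OF bounded_linear_mult_right l], of a 0] by simp

lemma has_derivative_product_fst_snd:
  assumes f: "\<And>x. (f has_real_derivative f' x) (at x)" and g: "\<And>x. (g has_real_derivative g' x) (at x)"
  shows "((\<lambda>p. complex_of_real (f (fst p) * g (snd p))) has_derivative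
     (\<lambda>v. complex_of_real (f' (fst p) * g (snd p) * fst v + f (fst p) * g' (snd p) * snd v))) (at p)"
proof -
  have "((\<lambda>p. f (fst p)) has_derivative (\<lambda>v. f' (fst p) * fst v)) (at p)"
    by (rule has_derivative_compose[OF has_derivative_fst[OF has_derivative_ident]
        f[unfolded has_field_derivative_def]])
  moreover have "((\<lambda>p. g (snd p)) has_derivative (\<lambda>v. g' (snd p) * snd v)) (at p)"
    by (rule has_derivative_compose[OF has_derivative_snd[OF has_derivative_ident]
        g[unfolded has_field_derivative_def]])
  ultimately have "((\<lambda>p. f (fst p) * g (snd p)) has_derivative
      (\<lambda>v. f (fst p) * (g' (snd p) * snd v) + f' (fst p) * fst v * g (snd p))) (at p)"
    by (rule has_derivative_mult)
  then have "((\<lambda>p. complex_of_real (f (fst p) * g (snd p))) has_derivative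
      (\<lambda>v. complex_of_real (f (fst p) * (g' (snd p) * snd v) + f' (fst p) * fst v * g (snd p)))) (at p)"
    by (rule has_derivative_of_real)
  then show ?thesis
    by (rule has_derivative_eq_rhs) (simp add: fun_eq_iff algebra_simps)
qed

lemma open_rectangle: "open (rectangle X1 X2)"
  by (simp add: rectangle_def open_Times)

lemma bounded_rectangle: "bounded (rectangle X1 X2)"
  by (simp add: rectangle_def bounded_Times)

definition sin_mode :: "real \<Rightarrow> real \<Rightarrow> real \<times> real \<Rightarrow> complex" where
  "sin_mode a b p = complex_of_real (sin (a * fst p) * sin (b * snd p))"

lemma smooth_sin_mode: "smooth_fun (sin_mode a b)"
  using smooth_fun_mult[OF smooth_fun_sin_mult[OF bounded_linear_fst] smooth_fun_sin_mult[OF bounded_linear_snd]]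
  by (simp add: sin_mode_def[abs_def])

lemma frechet_derivative_sin_mode:
  "frechet_derivative (sin_mode a b) (at p) v = complex_of_real
     (a * cos (a * fst p) * sin (b * snd p) * fst v + sin (a * fst p) * (b * cos (b * snd p)) * snd v)"
proof -
  have d: "((\<lambda>x. sin (c * x)) has_real_derivative c * cos (c * x)) (at x)" for c x :: real
    by (auto intro!: derivative_eq_intros)
  show ?thesis
    using frechet_derivative_at[OF has_derivative_product_fst_snd[OF d d, of a b p], symmetric]
    by (simp add: sin_mode_def[abs_def])
qed

text \<open>Products of cut-off sines in each variable are test functions of the rectangle. They and
  their gradients stay bounded and converge pointwise inside, so bounded convergence yields
  convergence in H^1.\<close>

lemma sin_mode_H10:
  assumes a: "sin (a * L1) = 0" and b: "sin (b * L2) = 0"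
  shows "(\<lambda>x. c * sin_mode a b x) \<in> H10 (rectangle L1 L2)"
proof -
  define V where "V = (\<lambda>k p. complex_of_real (truncated_sin a L1 k (fst p) * truncated_sin b L2 k (snd p)))"
  define U where "U = (\<lambda>k p. c * V k p)"
  let ?u = "\<lambda>x. c * sin_mode a b x" and ?S = "rectangle L1 L2"
  have smV: "smooth_fun (V k)" for k
  proof -
    have "smooth_fun (\<lambda>p. complex_of_real (sin (a * fst p)) * complex_of_real (cutoff L1 k (fst p)) *
       (complex_of_real (sin (b * snd p)) * complex_of_real (cutoff L2 k (snd p))))"
      by (intro smooth_fun_mult smooth_fun_sin_mult smooth_fun_cutoff bounded_linear_fst bounded_linear_snd)
    then show ?thesis
      by (simp add: V_def truncated_sin_def)
  qed
  have smU: "smooth_fun (U k)" for k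
    unfolding U_def by (intro smooth_fun_mult smooth_fun_const smV)
  have smu: "smooth_fun ?u"
    by (intro smooth_fun_mult smooth_fun_const smooth_sin_mode)
  have U': "frechet_derivative (U k) (at p) v = c * complex_of_real
     (truncated_sin' a L1 k (fst p) * truncated_sin b L2 k (snd p) * fst v +
      truncated_sin a L1 k (fst p) * truncated_sin' b L2 k (snd p) * snd v)" for k p v
    using frechet_derivative_at[OF has_derivative_mult_right[of _ _ _ c, OF has_derivative_product_fst_snd[OF
      truncated_sin_has_derivative truncated_sin_has_derivative, of a L1 k b L2 k p]], symmetric]
    by (simp add: V_def U_def)
  have u': "frechet_derivative ?u (at p) v = c * frechet_derivative (sin_mode a b) (at p) v" for p v
    using frechet_derivative_at[OF has_derivative_mult_right[of _ _ _ c, OF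
      smooth_fun_derivative[OF smooth_sin_mode, of a b p]], symmetric] by simp
  have test: "U k \<in> test_functions ?S" for k
  proof -
    let ?K = "{1 / real (Suc k)..L1 - 1 / real (Suc k)} \<times> {1 / real (Suc k)..L2 - 1 / real (Suc k)}"
    have "{p. U k p \<noteq> 0} \<subseteq> ?K"
      using cutoff_nonzero[of L1 k] cutoff_nonzero[of L2 k]
      by (auto simp: U_def V_def truncated_sin_def)
    then have cl: "closure {p. U k p \<noteq> 0} \<subseteq> ?K"
      by (rule closure_minimal) (intro closed_Times closed_atLeastAtMost)
    have "compact ?K"
      by (intro compact_Times compact_Icc)
    from compact_Int_closed[OF this closed_closure[of "{p. U k p \<noteq> 0}"]]
    have "compact (closure {p. U k p \<noteq> 0})"
      unfolding Int_absorb1[OF cl] .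
    moreover have "?K \<subseteq> ?S"
    proof -
      have "{d..L - d} \<subseteq> {0<..<L}" if "0 < d" for d L :: real
        using that by auto
      then show ?thesis
        unfolding rectangle_def by (intro Sigma_mono) auto
    qed
    ultimately show ?thesis
      unfolding test_functions_def mem_Collect_eq
      by (intro conjI smU order_trans[OF cl])
  qed
  have meas: "f \<in> borel_measurable borel" if "smooth_fun f" for f :: "real \<times> real \<Rightarrow> complex"
    by (intro borel_measurable_continuous_onI smooth_fun_continuous_on that)
  have "H1_approximates ?S U ?u"
    unfolding H1_approximates_def
  proof (intro conjI ballI exI)
    show "(\<lambda>k. L2norm (lborel_on ?S) (\<lambda>x. U k x - ?u x)) \<longlonglongrightarrow> 0"
    proof (rule L2norm_tendsto_0[OF open_rectangle bounded_rectangle, where C = "2 * cmod c"])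
      show "(\<lambda>x. U k x - ?u x) \<in> borel_measurable borel" for k
        by (intro borel_measurable_diff meas smU smu)
      fix p assume p: "p \<in> ?S"
      then have x: "0 < fst p" "fst p < L1" and y: "0 < snd p" "snd p < L2"
        by (auto simp: rectangle_def)
      have "(\<lambda>k. U k p - ?u p) \<longlonglongrightarrow> c * complex_of_real (sin (a * fst p) * sin (b * snd p)) - ?u p"
        unfolding U_def V_def
        by (intro tendsto_intros truncated_sin_props(3)[OF a x] truncated_sin_props(3)[OF b y])
      then show "(\<lambda>k. U k p - ?u p) \<longlonglongrightarrow> 0" by (simp add: sin_mode_def)
      fix k
      have "cmod (V k p) \<le> 1" "cmod (sin_mode a b p) \<le> 1"
        using truncated_sin_props(1)[OF a x, of k] truncated_sin_props(1)[OF b y, of k]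
        by (auto simp: V_def sin_mode_def abs_mult norm_mult intro!: mult_le_one)
      then have "cmod (V k p - sin_mode a b p) \<le> 2"
        using norm_triangle_ineq4[of "V k p" "sin_mode a b p"] by linarith
      then have "cmod c * cmod (V k p - sin_mode a b p) \<le> cmod c * 2"
        by (rule mult_left_mono) simp
      then show "cmod (U k p - ?u p) \<le> 2 * cmod c"
        by (simp add: U_def norm_mult flip: right_diff_distrib)
    qed
    fix e :: "real \<times> real" assume "e \<in> Basis"
    show "is_weak_deriv ?S e ?u (\<lambda>x. frechet_derivative ?u (at x) e)"
      by (rule smooth_is_weak_deriv[OF smu open_rectangle bounded_rectangle])
    show "(\<lambda>k. L2norm (lborel_on ?S) (\<lambda>x. frechet_derivative (U k) (at x) e -
        frechet_derivative ?u (at x) e)) \<longlonglongrightarrow> 0"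
    proof (rule L2norm_tendsto_0[OF open_rectangle bounded_rectangle,
          where C = "cmod c * (6 * (\<bar>a\<bar> * \<bar>fst e\<bar> + \<bar>b\<bar> * \<bar>snd e\<bar>))"])
      show "(\<lambda>x. frechet_derivative (U k) (at x) e - frechet_derivative ?u (at x) e) \<in> borel_measurable borel" for k
        by (intro borel_measurable_diff meas smooth_fun_frechet_derivative smU smu)
      fix p assume p: "p \<in> ?S"
      then have x: "0 < fst p" "fst p < L1" and y: "0 < snd p" "snd p < L2"
        by (auto simp: rectangle_def)
      have "(\<lambda>k. frechet_derivative (U k) (at p) e - frechet_derivative ?u (at p) e) \<longlonglongrightarrow>
          c * complex_of_real (a * cos (a * fst p) * sin (b * snd p) * fst e +
             sin (a * fst p) * (b * cos (b * snd p)) * snd e) - frechet_derivative ?u (at p) e"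
        unfolding U'
        by (intro tendsto_intros truncated_sin_props[OF a x] truncated_sin_props[OF b y])
      then show "(\<lambda>k. frechet_derivative (U k) (at p) e - frechet_derivative ?u (at p) e) \<longlonglongrightarrow> 0"
        by (simp add: u' frechet_derivative_sin_mode)
      fix k
      have 1: "\<bar>r * s * t\<bar> \<le> B * \<bar>t\<bar>" if "\<bar>r\<bar> \<le> B" "\<bar>s\<bar> \<le> 1" for r s t B :: real
        using mult_mono[OF that] that by (auto simp: abs_mult intro!: mult_right_mono)
      have 2: "\<bar>s * r * t\<bar> \<le> B * \<bar>t\<bar>" if "\<bar>r\<bar> \<le> B" "\<bar>s\<bar> \<le> 1" for r s t B :: real
        using 1[OF that, of t] by (simp only: mult.commute[of s r])
      \<comment> \<open>The terms of the approximating gradient are bounded with the factor 5, those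
        of the limit with the factor 1, whence 6.\<close>
      have 3: "\<bar>(t3 + t4) - (t1 + t2)\<bar> \<le> 6 * (B1 + B2)"
        if "\<bar>t1\<bar> \<le> B1" "\<bar>t2\<bar> \<le> B2" "\<bar>t3\<bar> \<le> 5 * B1" "\<bar>t4\<bar> \<le> 5 * B2" for t1 t2 t3 t4 B1 B2 :: real
        using that by (auto simp: abs_le_iff)
      have "\<bar>a * cos (a * fst p)\<bar> \<le> \<bar>a\<bar>" "\<bar>b * cos (b * snd p)\<bar> \<le> \<bar>b\<bar>"
        by (auto simp: abs_mult mult_left_le)
      note bounds = 1[OF this(1), of "sin (b * snd p)" "fst e"] 2[OF this(2), of "sin (a * fst p)" "snd e"]
        1[OF truncated_sin_props(2)[OF a x, of k] truncated_sin_props(1)[OF b y, of k], of "fst e"]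
        2[OF truncated_sin_props(2)[OF b y, of k] truncated_sin_props(1)[OF a x, of k], of "snd e"]
      have "\<bar>(truncated_sin' a L1 k (fst p) * truncated_sin b L2 k (snd p) * fst e +
      truncated_sin a L1 k (fst p) * truncated_sin' b L2 k (snd p) * snd e) -
       (a * cos (a * fst p) * sin (b * snd p) * fst e +
             sin (a * fst p) * (b * cos (b * snd p)) * snd e)\<bar> \<le>
          6 * (\<bar>a\<bar> * \<bar>fst e\<bar> + \<bar>b\<bar> * \<bar>snd e\<bar>)"
        using bounds by (intro 3) (simp_all only: mult.assoc abs_sin_le_one)
      then have "cmod c * \<bar>(truncated_sin' a L1 k (fst p) * truncated_sin b L2 k (snd p) * fst e +
      truncated_sin a L1 k (fst p) * truncated_sin' b L2 k (snd p) * snd e) -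
       (a * cos (a * fst p) * sin (b * snd p) * fst e +
             sin (a * fst p) * (b * cos (b * snd p)) * snd e)\<bar> \<le>
          cmod c * (6 * (\<bar>a\<bar> * \<bar>fst e\<bar> + \<bar>b\<bar> * \<bar>snd e\<bar>))"
        by (rule mult_left_mono) simp
      then show "cmod (frechet_derivative (U k) (at p) e - frechet_derivative ?u (at p) e) \<le>
          cmod c * (6 * (\<bar>a\<bar> * \<bar>fst e\<bar> + \<bar>b\<bar> * \<bar>snd e\<bar>))"
        unfolding U' u' frechet_derivative_sin_mode
        by (simp only: norm_mult norm_of_real flip: right_diff_distrib of_real_diff)
    qed
  qed
  then show ?thesis
    using test unfolding H10_def by blast
qed

section \<open>The dual norm\<close>

lemma H10_square_integrable:
  assumes "u \<in> H10 S"
  shows "square_integrable (lborel_on S) u"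
proof -
  obtain b :: 'a where "b \<in> Basis"
    using nonempty_Basis by blast
  then show ?thesis
    using assms unfolding H10_def H1_approximates_def is_weak_deriv_def by blast
qed

lemma L2norm_le_H1_norm: "L2norm (lborel_on S) u \<le> H1_norm S u"
  unfolding H1_norm_def by (rule real_le_rsqrt) (simp add: sum_nonneg)

lemma H1_norm_nonneg: "0 \<le> H1_norm S u"
  by (simp add: H1_norm_def sum_nonneg)

lemma square_integrable_integrable:
  assumes "finite_measure M" "square_integrable M u"
  shows "integrable M u"
proof -
  interpret finite_measure M by fact
  have "integrable M (\<lambda>x. cmod (u x))"
    by (rule square_integrable_imp_integrable)
       (use assms(2) in \<open>auto simp: square_integrable_def\<close>)
  then show ?thesis
    using assms(2) by (simp add: integrable_norm_iff square_integrable_def)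
qed

lemma square_integrable_bounded:
  assumes "finite_measure M" "f \<in> borel_measurable M" "\<And>x. cmod (f x) \<le> C"
  shows "square_integrable M f"
proof -
  interpret finite_measure M by fact
  have "integrable M (\<lambda>x. (cmod (f x))\<^sup>2)"
    using assms by (intro integrable_const_bound[where B="C\<^sup>2"] AE_I2) (simp_all add: power_mono)
  then show ?thesis
    using assms by (simp add: square_integrable_def)
qed

text \<open>Cauchy--Schwarz against the constant function: integrate the square of \<open>\<bar>u\<bar> - m / (V + 1)\<close>.\<close>

lemma integral_cmod_le_L2norm:
  assumes "finite_measure M" "square_integrable M u"
  shows "(\<integral>x. cmod (u x) \<partial>M) \<le> sqrt (measure M (space M) + 1) * L2norm M u"
proof -
  interpret finite_measure M by fact
  define V where "V = measure M (space M)"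
  define m where "m = (\<integral>x. cmod (u x) \<partial>M)"
  \<comment> \<open>\<open>V + 1\<close> in place of the total mass \<open>V\<close> keeps the
    quotient meaningful for the zero measure, at the price of a slightly larger constant.\<close>
  define s where "s = m / (V + 1)"
  have V: "V \<ge> 0" by (simp add: V_def)
  have i: "integrable M (\<lambda>x. cmod (u x))" "integrable M (\<lambda>x. (cmod (u x))\<^sup>2)"
    using square_integrable_integrable[OF assms] assms(2)
    by (auto simp: square_integrable_def)
  have m: "m = s * (V + 1)"
    using V by (simp add: s_def)
  have m2: "m\<^sup>2 / (V + 1) = s\<^sup>2 * (V + 1)"
    using V by (simp add: m power2_eq_square)
  have "0 \<le> (\<integral>x. (cmod (u x) - s)\<^sup>2 \<partial>M)"
    by (rule integral_nonneg_AE) simp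
  also have "(\<integral>x. (cmod (u x) - s)\<^sup>2 \<partial>M) = (\<integral>x. (cmod (u x))\<^sup>2 - 2 * s * cmod (u x) + s\<^sup>2 \<partial>M)"
    by (simp add: power2_diff algebra_simps)
  also have "\<dots> = (\<integral>x. (cmod (u x))\<^sup>2 \<partial>M) - 2 * s * m + s\<^sup>2 * V"
    using i by (simp add: m_def V_def)
  also have "\<dots> \<le> (\<integral>x. (cmod (u x))\<^sup>2 \<partial>M) - 2 * s * m + s\<^sup>2 * (V + 1)"
    by (simp add: algebra_simps)
  also have "\<dots> = (\<integral>x. (cmod (u x))\<^sup>2 \<partial>M) - m\<^sup>2 / (V + 1)"
    unfolding m2 by (simp add: m power2_eq_square algebra_simps)
  finally have "m\<^sup>2 \<le> (V + 1) * (\<integral>x. (cmod (u x))\<^sup>2 \<partial>M)"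
    using V by (simp add: field_simps)
  then have "m \<le> sqrt ((V + 1) * (\<integral>x. (cmod (u x))\<^sup>2 \<partial>M))"
    by (rule real_le_rsqrt)
  then show ?thesis
    by (simp add: m_def V_def L2norm_def real_sqrt_mult)
qed

text \<open>A bounded function acts through the L^2 pairing: the modulus is at most C times the
  integral of |u|, which the finite measure bounds by the L^2 norm and hence by the H^1 norm. It
  places the target state in H^-1.\<close>

lemma pairing_in_Hm1:
  fixes \<phi> :: "'a::euclidean_space \<Rightarrow> complex"
  assumes S: "open S" "bounded S" and \<phi>: "\<phi> \<in> borel_measurable borel" "\<And>x. cmod (\<phi> x) \<le> C"
  shows "(\<lambda>u. \<integral>x. \<phi> x * cnj (u x) \<partial>lborel_on S) \<in> Hm1 S"
proof -
  let ?M = "lborel_on S"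
  interpret finite_measure ?M
    by (rule finite_measure_lborel_on[OF S])
  have C: "C \<ge> 0"
    using \<phi>(2) norm_ge_zero order_trans by blast
  have int: "integrable ?M u" if "u \<in> H10 S" for u
    by (intro square_integrable_integrable H10_square_integrable that finite_measure_axioms)
  have meas: "\<phi> \<in> borel_measurable ?M"
    using \<phi>(1) by (intro measurable_restrict_space1) simp
  have int': "integrable ?M (\<lambda>x. \<phi> x * cnj (u x))" if "u \<in> H10 S" for u
  proof (rule Bochner_Integration.integrable_bound[where f="\<lambda>x. C * cmod (u x)"])
    show "integrable ?M (\<lambda>x. C * cmod (u x))"
      using int[OF that] by simp
    show "(\<lambda>x. \<phi> x * cnj (u x)) \<in> borel_measurable ?M"
      using meas measurable_compose[OF borel_measurable_integrable[OF int[OF that]]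
          borel_measurable_continuous_onI[OF continuous_on_cnj[OF continuous_on_id]]]
      by (rule borel_measurable_times)
    show "AE x in ?M. norm (\<phi> x * cnj (u x)) \<le> norm (C * cmod (u x))"
      using \<phi>(2) C by (auto simp: norm_mult intro!: mult_right_mono)
  qed
  have bound: "cmod (\<integral>x. \<phi> x * cnj (u x) \<partial>?M) \<le>
      (C * sqrt (measure ?M (space ?M) + 1)) * H1_norm S u" if u: "u \<in> H10 S" for u
  proof -
    have "cmod (\<integral>x. \<phi> x * cnj (u x) \<partial>?M) \<le> (\<integral>x. norm (\<phi> x * cnj (u x)) \<partial>?M)"
      by (rule integral_norm_bound)
    also have "\<dots> \<le> (\<integral>x. C * cmod (u x) \<partial>?M)"
      using int[OF u] integrable_norm[OF int'[OF u]] \<phi>(2)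
      by (intro integral_mono) (auto simp: norm_mult intro!: mult_right_mono)
    also have "\<dots> \<le> C * (sqrt (measure ?M (space ?M) + 1) * L2norm ?M u)"
      using integral_cmod_le_L2norm[OF finite_measure_axioms H10_square_integrable[OF u]] C
      by (simp add: mult_left_mono)
    also have "\<dots> \<le> C * (sqrt (measure ?M (space ?M) + 1) * H1_norm S u)"
      using C L2norm_le_H1_norm by (intro mult_left_mono) auto
    finally show ?thesis by (simp add: mult.assoc)
  qed
  have "(\<integral>x. \<phi> x * cnj (u x + v x) \<partial>?M) = (\<integral>x. \<phi> x * cnj (u x) \<partial>?M) + (\<integral>x. \<phi> x * cnj (v x) \<partial>?M)"
    if "u \<in> H10 S" "v \<in> H10 S" for u v
    using int'[OF that(1)] int'[OF that(2)] by (simp add: distrib_left)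
  moreover have "(\<integral>x. \<phi> x * cnj (c * u x) \<partial>?M) = cnj c * (\<integral>x. \<phi> x * cnj (u x) \<partial>?M)" for c u
    by (simp add: mult.left_commute)
  ultimately show ?thesis
    unfolding Hm1_def using bound by blast
qed

lemma zero_in_Hm1: "(\<lambda>_. 0) \<in> Hm1 S"
  unfolding Hm1_def by (auto intro!: exI[of _ 0])

lemma Hm1_diff:
  assumes "F \<in> Hm1 S" "G \<in> Hm1 S"
  shows "(\<lambda>u. F u - G u) \<in> Hm1 S"
proof -
  obtain C D where C: "\<And>u. u \<in> H10 S \<Longrightarrow> cmod (F u) \<le> C * H1_norm S u"
    and D: "\<And>u. u \<in> H10 S \<Longrightarrow> cmod (G u) \<le> D * H1_norm S u"
    using assms unfolding Hm1_def by blast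
  have "cmod (F u - G u) \<le> (C + D) * H1_norm S u" if "u \<in> H10 S" for u
    using norm_triangle_ineq4[of "F u" "G u"] C[OF that] D[OF that] by (simp add: distrib_right)
  then have "\<exists>E. \<forall>u\<in>H10 S. cmod (F u - G u) \<le> E * H1_norm S u"
    by blast
  with assms show ?thesis
    unfolding Hm1_def mem_Collect_eq by (simp add: right_diff_distrib)
qed

text \<open>The real supremum in \<open>Hm1_norm\<close> dominates its members only once the set is
  known to be bounded above; the constant \<open>C\<close> from membership in \<open>Hm1\<close>
  ensures this.\<close>

lemma Hm1_norm_bound:
  assumes F: "F \<in> Hm1 S" and u: "u \<in> H10 S"
  shows "cmod (F u) \<le> Hm1_norm S F * H1_norm S u"
proof -
  obtain C where C: "\<And>u. u \<in> H10 S \<Longrightarrow> cmod (F u) \<le> C * H1_norm S u"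
    using F unfolding Hm1_def by blast
  have "cmod (F v) / H1_norm S v \<le> \<bar>C\<bar>" if "v \<in> H10 S" for v
  proof (cases "H1_norm S v = 0")
    case False
    then have "0 < H1_norm S v"
      using H1_norm_nonneg[of S v] by linarith
    moreover have "C * H1_norm S v \<le> \<bar>C\<bar> * H1_norm S v"
      using H1_norm_nonneg by (intro mult_right_mono) auto
    ultimately show ?thesis
      using order_trans[OF C[OF that]] by (simp add: divide_le_eq)
  qed simp
  then have "bdd_above ((\<lambda>v. cmod (F v) / H1_norm S v) ` H10 S)"
    by (rule bdd_aboveI2)
  then have *: "cmod (F u) / H1_norm S u \<le> Hm1_norm S F"
    unfolding Hm1_norm_def by (rule cSUP_upper[OF u])
  \<comment> \<open>For a vanishing norm, division by zero makes the quotient 0 and the supremum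
    says nothing about \<open>F u\<close>; there the bound by \<open>C\<close> applies
    directly.\<close>
  show ?thesis
  proof (cases "H1_norm S u = 0")
    case True
    then show ?thesis using C[OF u] by simp
  next
    case False
    then have "0 < H1_norm S u"
      using H1_norm_nonneg[of S u] by linarith
    then show ?thesis
      using * by (simp add: divide_le_eq)
  qed
qed

text \<open>Each component norm is at most the Euclidean norm of the vector. Summing the
  componentwise bounds gives a cruder constant than Cauchy-Schwarz, but one that depends on \<zeta>
  alone.\<close>

lemma Hm1_norm_vec_bound:
  assumes "\<And>i. i < n \<Longrightarrow> F i \<in> Hm1 S" "\<And>i. i < n \<Longrightarrow> \<zeta> i \<in> H10 S"
  shows "cmod (\<Sum>i<n. F i (\<zeta> i)) \<le> Hm1_norm_vec n S F * (\<Sum>i<n. H1_norm S (\<zeta> i))"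
proof -
  have "Hm1_norm S (F i) \<le> Hm1_norm_vec n S F" if "i < n" for i
    unfolding Hm1_norm_vec_def
    by (rule real_le_rsqrt) (use that in \<open>auto intro: member_le_sum\<close>)
  then have "cmod (F i (\<zeta> i)) \<le> Hm1_norm_vec n S F * H1_norm S (\<zeta> i)" if "i < n" for i
    using Hm1_norm_bound[OF assms(1)[OF that] assms(2)[OF that]] H1_norm_nonneg[of S "\<zeta> i"] that
    by (meson mult_right_mono order_trans)
  then have "(\<Sum>i<n. cmod (F i (\<zeta> i))) \<le> (\<Sum>i<n. Hm1_norm_vec n S F * H1_norm S (\<zeta> i))"
    by (intro sum_mono) auto
  then show ?thesis
    using norm_sum[of "\<lambda>i. F i (\<zeta> i)" "{..<n}"] by (simp add: sum_distrib_left)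
qed

section \<open>Normal derivatives on the rectangle\<close>

lemma finite_measure_boundary: "finite_measure (boundary_measure X1 X2)"
proof -
  have "finite_measure (lborel_on {0..2 * X1 + 2 * X2})"
    using emeasure_bounded_finite[of "{0..2 * X1 + 2 * X2}"]
    by (intro finite_measureI) (simp add: emeasure_restrict_space space_restrict_space)
  moreover have "boundary_param X1 X2 \<in> borel_measurable borel"
    unfolding boundary_param_def by measurable
  then have "boundary_param X1 X2 \<in> borel_measurable (lborel_on {0..2 * X1 + 2 * X2})"
    by (intro measurable_restrict_space1) simp
  ultimately show ?thesis
    unfolding boundary_measure_def by (rule finite_measure.finite_measure_distr)
qed

lemma sets_boundary_measure: "sets (boundary_measure X1 X2) = sets borel"
  by (simp add: boundary_measure_def)

lemma finite_measure_boundary_cylinder: "finite_measure (boundary_cylinder_measure X1 X2 T)"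
proof -
  have "finite_measure (lborel_on {0<..<T})"
    by (rule finite_measure_lborel_on) auto
  then show ?thesis
    unfolding boundary_cylinder_measure_def
    by (intro finite_measure_pair_measure finite_measure_boundary)
qed

lemma outward_normal_measurable: "outward_normal X1 X2 \<in> borel_measurable borel"
proof -
  have "closed {x :: real \<times> real. fst x = c}" "closed {x :: real \<times> real. snd x = c}" for c
    by (intro closed_Collect_eq continuous_intros)+
  then have "{x \<in> space borel. fst x = c} \<in> sets (borel :: (real \<times> real) measure)"
    "{x \<in> space borel. snd x = c} \<in> sets (borel :: (real \<times> real) measure)" for c
    by simp_all
  then show ?thesis
    unfolding outward_normal_def[abs_def] by (intro measurable_If measurable_const) auto
qed

text \<open>The constant sequence \<open>v\<close> approximates itself. Global boundedness supplies
  square integrability on the boundary, whose total length is finite.\<close>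

lemma smooth_has_trace:
  assumes v: "smooth_fun v" "\<And>x. cmod (v x) \<le> C"
  shows "has_trace X1 X2 v v"
  unfolding has_trace_def
proof (intro conjI exI allI)
  have "v \<in> borel_measurable (boundary_measure X1 X2)"
    using borel_measurable_continuous_onI[OF smooth_fun_continuous_on[OF v(1)]]
    by (simp cong: measurable_cong_sets add: measurable_cong_sets[OF sets_boundary_measure refl])
  then show "square_integrable (boundary_measure X1 X2) v"
    by (rule square_integrable_bounded[OF finite_measure_boundary _ v(2)])
  show "smooth_fun v" by fact
  show "H1_approximates (rectangle X1 X2) (\<lambda>_. v) v"
    unfolding H1_approximates_def
    using smooth_is_weak_deriv[OF v(1) open_rectangle bounded_rectangle]
    by (auto simp: L2norm_def intro!: exI)
  show "(\<lambda>k::nat. L2norm (boundary_measure X1 X2) (\<lambda>x. v x - v x)) \<longlonglongrightarrow> 0"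
    by (simp add: L2norm_def)
qed

text \<open>Linearity of the derivative expands the outward derivative in the coordinates of the
  normal, the form that \<open>has_normal_deriv\<close> prescribes; each partial derivative serves
  as its own trace.\<close>

lemma smooth_has_normal_deriv:
  assumes u: "smooth_fun u" and C: "\<And>b x. b \<in> Basis \<Longrightarrow> cmod (frechet_derivative u (at x) b) \<le> C b"
  shows "has_normal_deriv X1 X2 u (\<lambda>x. frechet_derivative u (at x) (outward_normal X1 X2 x))"
proof -
  let ?v = "\<lambda>b x. frechet_derivative u (at x) b"
  have "is_weak_deriv (rectangle X1 X2) b u (?v b) \<and> has_trace X1 X2 (?v b) (?v b)" if "b \<in> Basis" for b
    using smooth_is_weak_deriv[OF u open_rectangle bounded_rectangle]
      smooth_has_trace[OF smooth_fun_frechet_derivative[OF u] C[OF that]] by blast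
  moreover have "frechet_derivative u (at x) (outward_normal X1 X2 x) =
      (\<Sum>b\<in>Basis. of_real (inner (outward_normal X1 X2 x) b) * frechet_derivative u (at x) b)" for x
  proof -
    have l: "linear (frechet_derivative u (at x))"
      by (rule has_derivative_linear[OF smooth_fun_derivative[OF u]])
    have "frechet_derivative u (at x) (outward_normal X1 X2 x) =
        frechet_derivative u (at x) (\<Sum>b\<in>Basis. inner (outward_normal X1 X2 x) b *\<^sub>R b)"
      by (simp only: euclidean_representation)
    also have "\<dots> = (\<Sum>b\<in>Basis. inner (outward_normal X1 X2 x) b *\<^sub>R frechet_derivative u (at x) b)"
      unfolding linear_sum[OF l] linear_scale[OF l] ..
    finally show ?thesis
      by (simp add: scaleR_conv_of_real)
  qed
  ultimately show ?thesis
    unfolding has_normal_deriv_def by (intro exI[of _ ?v]) simp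
qed

section \<open>Time-independent functions on the cylinder and the Laplacian of a product of
  sines\<close>

lemma smooth_fun_snd:
  fixes u :: "real \<times> real \<Rightarrow> complex"
  assumes "smooth_fun u"
  shows "smooth_fun (\<lambda>p :: real \<times> real \<times> real. u (snd p))"
    and "frechet_derivative (\<lambda>p :: real \<times> real \<times> real. u (snd p)) (at p) v =
      frechet_derivative u (at (snd p)) (snd v)"
proof -
  have D: "((\<lambda>p :: real \<times> real \<times> real. u (snd p)) has_derivative
      (\<lambda>v. frechet_derivative u (at (snd p)) (snd v))) (at p)" if "cont_diff (Suc k) u" for u k p
    by (rule has_derivative_compose[OF has_derivative_snd[OF has_derivative_ident]
        cont_diff_derivative[OF that]])
  have "cont_diff k (\<lambda>p :: real \<times> real \<times> real. u (snd p))"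
    if "cont_diff k u" for k u
    using that
  proof (induction k arbitrary: u)
    case 0
    then show ?case
      unfolding cont_diff.simps
      by (rule continuous_on_compose2[OF _ continuous_on_snd[OF continuous_on_id]]) simp
  next
    case (Suc k)
    show ?case
      by (rule cont_diff_SucI[OF D[OF Suc.prems]])
         (use Suc in \<open>unfold cont_diff.simps, blast\<close>)
  qed
  then show "smooth_fun (\<lambda>p :: real \<times> real \<times> real. u (snd p))"
    using assms by (simp add: smooth_fun_def)
  have "cont_diff (Suc 0) u"
    using assms unfolding smooth_fun_def by blast
  from frechet_derivative_at[OF D[OF this, of p]]
  show "frechet_derivative (\<lambda>p :: real \<times> real \<times> real. u (snd p)) (at p) v =
      frechet_derivative u (at (snd p)) (snd v)"
    by (metis (no_types))
qed

lemma frechet_derivative_cmult: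
  assumes "smooth_fun u"
  shows "frechet_derivative (\<lambda>x. c * u x) (at x) v = c * frechet_derivative u (at x) v"
  by (rule arg_cong[where f="\<lambda>d. d v",
      OF frechet_derivative_at[OF has_derivative_mult_right[OF smooth_fun_derivative[OF assms]], symmetric]])

lemma sin_mode_laplacian:
  "(\<Sum>e\<in>Basis. frechet_derivative (\<lambda>x. frechet_derivative (sin_mode a b) (at x) e) (at x) e) =
     - complex_of_real (a\<^sup>2 + b\<^sup>2) * sin_mode a b x"
proof -
  have s: "((\<lambda>x. sin (c * x)) has_real_derivative c * cos (c * x)) (at x)" for c x :: real
    by (auto intro!: derivative_eq_intros)
  have c: "((\<lambda>x. c * cos (c * x)) has_real_derivative - (c\<^sup>2 * sin (c * x))) (at x)" for c x :: real
    by (auto intro!: derivative_eq_intros simp: power2_eq_square)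
  have 1: "(\<lambda>x. frechet_derivative (sin_mode a b) (at x) (1, 0)) =
      (\<lambda>p. complex_of_real (a * cos (a * fst p) * sin (b * snd p)))"
    "(\<lambda>x. frechet_derivative (sin_mode a b) (at x) (0, 1)) =
      (\<lambda>p. complex_of_real (sin (a * fst p) * (b * cos (b * snd p))))"
    by (simp_all add: frechet_derivative_sin_mode)
  show ?thesis
    unfolding sum_Basis_prod_eq Basis_prod_def
    using frechet_derivative_at[OF has_derivative_product_fst_snd[OF c s, of a b x], symmetric]
      frechet_derivative_at[OF has_derivative_product_fst_snd[OF s c, of a b x], symmetric]
    by (subst sum.union_disjoint)
       (auto simp: 1 sin_mode_def algebra_simps)
qed

lemma sin_mode_derivative_bound:
  "cmod (frechet_derivative (sin_mode a b) (at x) v) \<le> \<bar>a\<bar> * \<bar>fst v\<bar> + \<bar>b\<bar> * \<bar>snd v\<bar>"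
proof -
  have "\<bar>a * cos (a * fst x) * sin (b * snd x) * fst v\<bar> \<le> \<bar>a\<bar> * \<bar>fst v\<bar>"
    using mult_le_one[of "\<bar>cos (a * fst x)\<bar>" "\<bar>sin (b * snd x)\<bar>"]
      mult_left_mono[of "\<bar>cos (a * fst x)\<bar> * \<bar>sin (b * snd x)\<bar>" 1 "\<bar>a\<bar> * \<bar>fst v\<bar>"]
    by (simp add: abs_mult mult_ac)
  moreover have "\<bar>sin (a * fst x) * (b * cos (b * snd x)) * snd v\<bar> \<le> \<bar>b\<bar> * \<bar>snd v\<bar>"
    using mult_le_one[of "\<bar>sin (a * fst x)\<bar>" "\<bar>cos (b * snd x)\<bar>"]
      mult_left_mono[of "\<bar>sin (a * fst x)\<bar> * \<bar>cos (b * snd x)\<bar>" 1 "\<bar>b\<bar> * \<bar>snd v\<bar>"]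
    by (simp add: abs_mult mult_ac)
  ultimately show ?thesis
    unfolding frechet_derivative_sin_mode norm_of_real
    by (intro order_trans[OF abs_triangle_ineq] add_mono)
qed

lemma open_cylinder: "open (cylinder X1 X2 T)"
  by (simp add: cylinder_def open_Times open_rectangle)

lemma bounded_cylinder: "bounded (cylinder X1 X2 T)"
  by (simp add: cylinder_def bounded_Times bounded_rectangle)

section \<open>Matrices\<close>

lemma index_mat_adjoint:
  "i < dim_col A \<Longrightarrow> j < dim_row A \<Longrightarrow> mat_adjoint A $$ (i, j) = conjugate (A $$ (j, i))"
  by (simp add: mat_adjoint_def mat_of_rows_def)

lemma dim_mat_adjoint [simp]: "dim_row (mat_adjoint A) = dim_col A" "dim_col (mat_adjoint A) = dim_row A"
  by (simp_all add: mat_adjoint_def)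

definition diag_of :: "nat \<Rightarrow> (nat \<Rightarrow> complex) \<Rightarrow> complex mat" where
  "diag_of n d = mat n n (\<lambda>(i, j). if i = j then d i else 0)"

lemma dim_diag_of [simp]: "dim_row (diag_of n d) = n" "dim_col (diag_of n d) = n"
  by (simp_all add: diag_of_def)

lemma mat_adjoint_diag_of: "mat_adjoint (diag_of n d) = diag_of n (\<lambda>i. cnj (d i))"
  by (rule eq_matI) (auto simp: index_mat_adjoint, auto simp: diag_of_def)

lemma diag_of_mult_vec:
  assumes "i < n" "dim_vec v = n"
  shows "(diag_of n d *\<^sub>v v) $ i = d i * v $ i"
proof -
  have "(diag_of n d *\<^sub>v v) $ i = (\<Sum>j<n. (if i = j then d i else 0) * v $ j)"
    using assms by (simp add: diag_of_def scalar_prod_def lessThan_atLeast0)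
  also have "\<dots> = (\<Sum>j<n. if i = j then d i * v $ j else 0)"
    by (intro sum.cong) auto
  finally show ?thesis
    using assms by simp
qed

definition ones_mat :: "nat \<Rightarrow> complex mat" where
  "ones_mat n = mat n 1 (\<lambda>_. 1)"

text \<open>An eigenvector of a diagonal matrix with distinct entries has a single nonzero
  coordinate, and the adjoint of the column of ones maps it to that coordinate. This is the
  Fattorini-Hautus condition.\<close>

lemma fattorini_diag_ones:
  assumes "inj d"
  shows "mat_kernel (\<theta> \<cdot>\<^sub>m 1\<^sub>m n - mat_adjoint (diag_of n d)) \<inter> mat_kernel (mat_adjoint (ones_mat n)) = {0\<^sub>v n}"
proof -
  let ?D = "\<theta> \<cdot>\<^sub>m 1\<^sub>m n - mat_adjoint (diag_of n d)"
  have dim: "dim_row (ones_mat n) = n" "dim_col (ones_mat n) = 1"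
    by (simp_all add: ones_mat_def)
  have D_eq: "?D = diag_of n (\<lambda>i. \<theta> - cnj (d i))"
    unfolding mat_adjoint_diag_of by (rule eq_matI) (auto simp: diag_of_def)
  have D: "?D \<in> carrier_mat n n" and B: "mat_adjoint (ones_mat n) \<in> carrier_mat 1 n"
    by (auto simp: dim intro!: carrier_matI)
  have "v = 0\<^sub>v n" if "v \<in> carrier_vec n" and v: "?D *\<^sub>v v = 0\<^sub>v n" "mat_adjoint (ones_mat n) *\<^sub>v v = 0\<^sub>v 1" for v
  proof -
    have [simp]: "dim_vec v = n" using that by simp
    have ev: "(\<theta> - cnj (d i)) * v $ i = 0" if "i < n" for i
      using v(1) diag_of_mult_vec[of i n v "\<lambda>i. \<theta> - cnj (d i)"] that unfolding D_eq by simp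
    have "(mat_adjoint (ones_mat n) *\<^sub>v v) $ 0 = (\<Sum>i<n. v $ i)"
      by (simp add: scalar_prod_def dim index_mat_adjoint lessThan_atLeast0)
         (simp add: ones_mat_def)
    then have sum: "(\<Sum>i<n. v $ i) = 0"
      using v(2) by simp
    have "v $ i = 0" if "i < n" for i
    proof (rule ccontr)
      assume i: "v $ i \<noteq> 0"
      have "v $ j = 0" if "j < n" "j \<noteq> i" for j
        using ev[OF \<open>i < n\<close>] ev[OF that(1)] i injD[OF \<open>inj d\<close>, of i j] that(2) by (auto dest: arg_cong[of _ _ cnj])
      then have "(\<Sum>j<n. v $ j) = (\<Sum>j<n. if j = i then v $ i else 0)"
        by (intro sum.cong) auto
      then show False
        using sum i that by simp
    qed
    then show ?thesis
      by (intro eq_vecI) auto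
  qed
  then have "mat_kernel ?D \<inter> mat_kernel (mat_adjoint (ones_mat n)) \<subseteq> {0\<^sub>v n}"
    using mat_kernelD[OF D] mat_kernelD[OF B] by blast
  moreover have "0\<^sub>v n \<in> mat_kernel M" if "M \<in> carrier_mat r n" for M :: "complex mat" and r
    by (rule mat_kernelI[OF that]) (use that in \<open>auto intro!: eq_vecI\<close>)
  from this[OF D] this[OF B] have "{0\<^sub>v n} \<subseteq> mat_kernel ?D \<inter> mat_kernel (mat_adjoint (ones_mat n))"
    by blast
  ultimately show ?thesis
    by (rule equalityI)
qed

section \<open>Stationary adjoint states\<close>

text \<open>The Laplacian multiplies each mode by minus a^2 + b^2, and the matching real diagonal
  entry adds the same amount back, so both sides of the backward equation are 0. Continuity in time
  is trivial for a constant.\<close>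

lemma stationary_adjoint_solution:
  fixes a b :: "nat \<Rightarrow> real" and c :: "nat \<Rightarrow> complex"
  assumes a: "\<And>i. sin (a i * X1) = 0" and b: "\<And>i. sin (b i * X2) = 0"
  shows "adjoint_solution X1 X2 (diag_of n (\<lambda>i. complex_of_real ((a i)\<^sup>2 + (b i)\<^sup>2))) \<tau>
    (\<lambda>i x. c i * sin_mode (a i) (b i) x) (\<lambda>i p. c i * sin_mode (a i) (b i) (snd p))"
proof -
  let ?A = "diag_of n (\<lambda>i. complex_of_real ((a i)\<^sup>2 + (b i)\<^sup>2))"
  let ?u = "\<lambda>i x. c i * sin_mode (a i) (b i) x"
  let ?z = "\<lambda>i (p :: real \<times> real \<times> real). ?u i (snd p)"
  let ?d = "\<lambda>i e x. frechet_derivative (?u i) (at x) e"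
  let ?D = "\<lambda>i e (p :: real \<times> real \<times> real). ?d i e (snd p)"
  let ?DD = "\<lambda>i e f (p :: real \<times> real \<times> real). frechet_derivative (?d i e) (at (snd p)) f"
  have sm: "smooth_fun (?u i)" for i
    by (intro smooth_fun_mult smooth_fun_const smooth_sin_mode)
  have weak: "is_weak_deriv (cylinder X1 X2 \<tau>) v (\<lambda>p. u (snd p))
      (\<lambda>p. frechet_derivative u (at (snd p)) (snd v))" if "smooth_fun u" for u v
    using smooth_is_weak_deriv[OF smooth_fun_snd(1)[OF that] open_cylinder bounded_cylinder, where b=v]
    by (simp add: smooth_fun_snd(2)[OF that])
  have lap: "(\<Sum>e\<in>Basis. ?DD i e e p) = - complex_of_real ((a i)\<^sup>2 + (b i)\<^sup>2) * ?z i p" for i p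
  proof -
    have "?d i e = (\<lambda>x. c i * frechet_derivative (sin_mode (a i) (b i)) (at x) e)" for e
      by (simp add: frechet_derivative_cmult[OF smooth_sin_mode])
    then have "?DD i e e p = c i * frechet_derivative (\<lambda>x. frechet_derivative (sin_mode (a i) (b i)) (at x) e)
        (at (snd p)) e" for e
      by (simp add: frechet_derivative_cmult[OF smooth_fun_frechet_derivative[OF smooth_sin_mode]])
    then have "(\<Sum>e\<in>Basis. ?DD i e e p) = c i * (- complex_of_real ((a i)\<^sup>2 + (b i)\<^sup>2) *
        sin_mode (a i) (b i) (snd p))"
      by (simp only: sum_distrib_left[symmetric] sin_mode_laplacian)
    then show ?thesis by (simp add: mult_ac)
  qed
  have "\<exists>dt d dd. \<forall>i<n.
        is_weak_deriv (cylinder X1 X2 \<tau>) (1, 0) (?z i) (dt i) \<and>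
        (\<forall>b\<in>Basis. is_weak_deriv (cylinder X1 X2 \<tau>) (0, b) (?z i) (d i b) \<and>
           (\<forall>c\<in>Basis. is_weak_deriv (cylinder X1 X2 \<tau>) (0, c) (d i b) (dd i b c))) \<and>
        (AE p in lborel_on (cylinder X1 X2 \<tau>).
           - dt i p = (\<Sum>b\<in>Basis. dd i b b p) +
             vec_index (mat_adjoint ?A *\<^sub>v vec n (\<lambda>j. ?z j p)) i)"
  proof (intro exI allI impI conjI ballI AE_I2)
    fix i assume i: "i < n"
    \<comment> \<open>The time derivative is written as the spatial derivative in direction 0, the
      spatial part of (1, 0), so that the single fact \<open>weak\<close> serves all directions; it
      vanishes by linearity.\<close>
    show "is_weak_deriv (cylinder X1 X2 \<tau>) (1, 0) (?z i) (?D i 0)"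
      using weak[OF sm, of "(1, 0)" i] by simp
    show "is_weak_deriv (cylinder X1 X2 \<tau>) (0, e) (?z i) (?D i e)" for e
      using weak[OF sm, of "(0, e)" i] by simp
    show "is_weak_deriv (cylinder X1 X2 \<tau>) (0, f) (?D i e) (?DD i e f)" for e f
      using weak[OF smooth_fun_frechet_derivative[OF sm, of i e], of "(0, f)"] by simp
    show "- ?D i 0 p = (\<Sum>e\<in>Basis. ?DD i e e p) + vec_index (mat_adjoint ?A *\<^sub>v vec n (\<lambda>j. ?z j p)) i" for p
    proof -
      have "?D i 0 p = 0"
        by (rule linear_0[OF has_derivative_linear[OF smooth_fun_derivative[OF sm]]])
      moreover have "vec_index (mat_adjoint ?A *\<^sub>v vec n (\<lambda>j. ?z j p)) i =
          complex_of_real ((a i)\<^sup>2 + (b i)\<^sup>2) * ?z i p"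
        unfolding mat_adjoint_diag_of using i by (subst diag_of_mult_vec) auto
      ultimately show ?thesis
        unfolding lap by (simp add: algebra_simps)
    qed
  qed
  then show ?thesis
    using sin_mode_H10[OF a b] by (simp add: adjoint_solution_def L2norm_def)
qed

definition mode_normal_deriv ::
  "real \<Rightarrow> real \<Rightarrow> real \<Rightarrow> real \<Rightarrow> complex \<Rightarrow> real \<times> real \<Rightarrow> complex" where
  "mode_normal_deriv X1 X2 a b c x =
     c * frechet_derivative (sin_mode a b) (at x) (outward_normal X1 X2 x)"

text \<open>The normal jumps at the corners, so measurability goes through its two measurable
  coordinates; square integrability follows from boundedness on a finite measure.\<close>

lemma stationary_lateral_normal_deriv:
  fixes a b :: "nat \<Rightarrow> real" and c :: "nat \<Rightarrow> complex"
  shows "has_lateral_normal_deriv n X1 X2 \<tau> (\<lambda>i p. c i * sin_mode (a i) (b i) (snd p))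
    (\<lambda>i p. mode_normal_deriv X1 X2 (a i) (b i) (c i) (snd p))"
  unfolding has_lateral_normal_deriv_def
proof (intro allI impI conjI AE_I2)
  fix i
  let ?u = "\<lambda>x. c i * sin_mode (a i) (b i) x" and ?q = "mode_normal_deriv X1 X2 (a i) (b i) (c i)"
  have q_eq: "?q = (\<lambda>x. frechet_derivative ?u (at x) (outward_normal X1 X2 x))"
    by (simp add: fun_eq_iff mode_normal_deriv_def frechet_derivative_cmult[OF smooth_sin_mode])
  have normal: "\<bar>fst (outward_normal X1 X2 x)\<bar> \<le> 1" "\<bar>snd (outward_normal X1 X2 x)\<bar> \<le> 1" for x
    by (auto simp: outward_normal_def)
  have bound: "cmod (frechet_derivative ?u (at x) v) \<le> cmod (c i) * (\<bar>a i\<bar> * \<bar>fst v\<bar> + \<bar>b i\<bar> * \<bar>snd v\<bar>)" for x v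
    unfolding frechet_derivative_cmult[OF smooth_sin_mode] norm_mult
    by (intro mult_left_mono sin_mode_derivative_bound norm_ge_zero)
  show "has_normal_deriv X1 X2 (\<lambda>x. c i * sin_mode (a i) (b i) (snd (t, x))) (\<lambda>x. ?q (snd (t, x)))" for t :: real
    unfolding q_eq snd_conv
    by (rule smooth_has_normal_deriv[OF _ bound]) (intro smooth_fun_mult smooth_fun_const smooth_sin_mode)
  show "square_integrable (boundary_cylinder_measure X1 X2 \<tau>) (\<lambda>p. ?q (snd p))"
  proof (rule square_integrable_bounded[OF finite_measure_boundary_cylinder])
    have cont: "f \<in> borel_measurable borel" if "continuous_on UNIV f" for f :: "real \<times> real \<Rightarrow> real"
      by (rule borel_measurable_continuous_onI[OF that])
    have nm: "(\<lambda>x. fst (outward_normal X1 X2 x)) \<in> borel_measurable borel"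
      "(\<lambda>x. snd (outward_normal X1 X2 x)) \<in> borel_measurable borel"
      by (rule measurable_compose[OF outward_normal_measurable], intro cont continuous_intros)+
    have "?q \<in> borel_measurable borel"
      unfolding mode_normal_deriv_def frechet_derivative_sin_mode
      by (intro borel_measurable_times borel_measurable_const measurable_compose[OF _ borel_measurable_of_real]
          borel_measurable_add nm cont continuous_intros)
    moreover have "snd \<in> measurable (boundary_cylinder_measure X1 X2 \<tau>) (borel :: (real \<times> real) measure)"
      using measurable_snd[of "lborel_on {0<..<\<tau>}" "boundary_measure X1 X2"]
      unfolding boundary_cylinder_measure_def
      by (simp add: measurable_cong_sets[OF refl sets_boundary_measure])
    ultimately show "(\<lambda>p. ?q (snd p)) \<in> borel_measurable (boundary_cylinder_measure X1 X2 \<tau>)"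
      by (rule measurable_compose[rotated])
    show "cmod (?q (snd p)) \<le> cmod (c i) * (\<bar>a i\<bar> + \<bar>b i\<bar>)" for p :: "real \<times> real \<times> real"
    proof -
      have "cmod (?q (snd p)) \<le> cmod (c i) * (\<bar>a i\<bar> * \<bar>fst (outward_normal X1 X2 (snd p))\<bar> +
          \<bar>b i\<bar> * \<bar>snd (outward_normal X1 X2 (snd p))\<bar>)"
        unfolding q_eq by (rule bound)
      also have "\<dots> \<le> cmod (c i) * (\<bar>a i\<bar> * 1 + \<bar>b i\<bar> * 1)"
        using normal by (intro mult_left_mono add_mono) auto
      finally show ?thesis by simp
    qed
  qed
qed

text \<open>The bounds by pi keep the zeros of both sines out of the open rectangle, so the
  integrand is positive there, and a nonempty open set is not null.\<close>

lemma sin_mode_L2_nonzero: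
  assumes "X1 > 0" "X2 > 0" "a > 0" "b > 0" "a * X1 \<le> pi" "b * X2 \<le> pi" "c \<noteq> 0"
  shows "(\<integral>x. c * sin_mode a b x * cnj (c * sin_mode a b x) \<partial>lborel_on (rectangle X1 X2)) \<noteq> 0"
proof
  let ?S = "rectangle X1 X2" and ?u = "\<lambda>x. c * sin_mode a b x"
  assume 0: "(\<integral>x. ?u x * cnj (?u x) \<partial>lborel_on ?S) = 0"
  have sq: "square_integrable (lborel_on ?S) ?u"
    by (intro continuous_square_integrable open_rectangle bounded_rectangle smooth_fun_continuous_on
        smooth_fun_mult smooth_fun_const smooth_sin_mode)
  have "(\<integral>x. ?u x * cnj (?u x) \<partial>lborel_on ?S) = complex_of_real (\<integral>x. (cmod (?u x))\<^sup>2 \<partial>lborel_on ?S)"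
    by (simp only: complex_norm_square[symmetric] integral_complex_of_real)
  with 0 have "(\<integral>x. (cmod (?u x))\<^sup>2 \<partial>lborel_on ?S) = 0"
    by simp
  then have "AE x in lborel_on ?S. (cmod (?u x))\<^sup>2 = 0"
    using sq by (subst (asm) integral_nonneg_eq_0_iff_AE) (auto simp: square_integrable_def)
  then have "emeasure (lborel_on ?S) {x \<in> space (lborel_on ?S). \<not> (cmod (?u x))\<^sup>2 = 0} = 0"
    by (rule AE_E2)
  moreover have "{x \<in> space (lborel_on ?S). \<not> (cmod (?u x))\<^sup>2 = 0} = ?S"
  proof -
    have sin_pos: "sin (r * t) > 0" if "0 < t" "t < X" "0 < r" "r * X \<le> pi" for r t X :: real
      using that by (intro sin_gt_zero less_le_trans[OF mult_strict_left_mono]) auto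
    have "sin (a * t) > 0" if "0 < t" "t < X1" for t
      using sin_pos[OF that] assms by simp
    moreover have "sin (b * t) > 0" if "0 < t" "t < X2" for t
      using sin_pos[OF that] assms by simp
    ultimately show ?thesis
      using \<open>c \<noteq> 0\<close> by (force simp: space_restrict_space rectangle_def sin_mode_def)
  qed
  ultimately have "emeasure lborel ?S = 0"
    using open_rectangle[of X1 X2] by (simp add: emeasure_restrict_space)
  then have "negligible ?S"
    using open_rectangle[of X1 X2] by (subst negligible_iff_emeasure0) auto
  moreover have "?S \<noteq> {}"
    using assms by (auto simp: rectangle_def)
  ultimately show False
    using open_not_negligible[OF open_rectangle] by blast
qed

section \<open>The unobservable combination of four modes\<close>

text \<open>The indices enumerate all pairs (p, q) with p in {1, 2} and q >= 1, p alternating, so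
  one definition covers every n and the first four indices are exactly p, q in {1, 2}. The factor 2
  in \<open>freq2\<close> matches the side pi/2.\<close>

definition freq1 :: "nat \<Rightarrow> real" where "freq1 i = real (1 + i mod 2)"
definition freq2 :: "nat \<Rightarrow> real" where "freq2 i = 2 * real (1 + i div 2)"

text \<open>On \<open>x\<^sub>1 = 0\<close> the normal derivatives of modes \<open>2 k\<close> and \<open>2 k + 1\<close> are proportional, with ratio
  \<open>1 : 2\<close>; on \<open>x\<^sub>2 = \<pi> / 2\<close> those of modes \<open>k\<close> and \<open>k + 2\<close> are, with ratio \<open>-1 : 2\<close>.\<close>

definition mode_coeff :: "nat \<Rightarrow> complex" where
  "mode_coeff i = (if i = 0 then -4 else if i = 1 then 2 else if i = 2 then -2 else if i = 3 then 1 else 0)"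

text \<open>Modulo 4 the value p^2 + 4 q^2 is 1 for p = 1 and 0 for p = 2, so it determines p; what
  remains determines q^2 and, q being positive, q.\<close>

lemma inj_mode_eigenvalue: "inj (\<lambda>i. complex_of_real ((freq1 i)\<^sup>2 + (freq2 i)\<^sup>2))"
proof (rule injI)
  fix i j
  assume "complex_of_real ((freq1 i)\<^sup>2 + (freq2 i)\<^sup>2) = complex_of_real ((freq1 j)\<^sup>2 + (freq2 j)\<^sup>2)"
  then have "(freq1 i)\<^sup>2 + (freq2 i)\<^sup>2 = (freq1 j)\<^sup>2 + (freq2 j)\<^sup>2"
    by (simp only: of_real_eq_iff)
  then have "real ((1 + i mod 2)\<^sup>2 + 4 * (1 + i div 2)\<^sup>2) = real ((1 + j mod 2)\<^sup>2 + 4 * (1 + j div 2)\<^sup>2)"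
    by (simp add: freq1_def freq2_def power2_eq_square algebra_simps)
  then have eq: "(1 + i mod 2)\<^sup>2 + 4 * (1 + i div 2)\<^sup>2 = (1 + j mod 2)\<^sup>2 + 4 * (1 + j div 2)\<^sup>2"
    by (simp only: of_nat_eq_iff)
  have m: "k mod 2 = 0 \<or> k mod 2 = 1" for k :: nat
    by linarith
  have "(1 + i mod 2)\<^sup>2 mod 4 = (1 + j mod 2)\<^sup>2 mod 4"
    using arg_cong[OF eq, of "\<lambda>k. k mod 4"] by simp
  then have p: "i mod 2 = j mod 2"
    using m[of i] m[of j] by (auto simp: power2_eq_square)
  then have "(1 + i div 2)\<^sup>2 = (1 + j div 2)\<^sup>2"
    using eq by simp
  then have "i div 2 = j div 2"
    by (simp add: power2_eq_iff_nonneg)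
  with p show "i = j"
    by (metis div_mult_mod_eq)
qed

lemma sin_freq: "sin (freq1 i * pi) = 0" "sin (freq2 i * (pi / 2)) = 0"
proof -
  show "sin (freq1 i * pi) = 0"
    unfolding freq1_def by (rule sin_npi)
  have "freq2 i * (pi / 2) = real (1 + i div 2) * pi"
    by (simp add: freq2_def)
  then show "sin (freq2 i * (pi / 2)) = 0"
    by (simp only: sin_npi)
qed

text \<open>The coefficients factor as a_p b_q with a = (-2, 1) and b = (2, 1). On the left side the
  sum over p of p a_p = -2 + 2 factors out, on the top side the sum over q of 2 q cos (q pi) b_q =
  -4 + 4.\<close>

lemma normal_deriv_sum_zero:
  assumes n: "n \<ge> 4" and x: "x \<in> {0} \<times> {0<..<pi / 2} \<union> {0<..<pi} \<times> {pi / 2}"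
  shows "(\<Sum>i<n. mode_normal_deriv pi (pi / 2) (freq1 i) (freq2 i) (mode_coeff i) x) = 0"
proof -
  let ?q = "\<lambda>i. mode_normal_deriv pi (pi / 2) (freq1 i) (freq2 i) (mode_coeff i) x"
  have "(\<Sum>i<n. ?q i) = (\<Sum>i<4. ?q i)"
    using n by (intro sum.mono_neutral_right) (auto simp: mode_normal_deriv_def mode_coeff_def)
  also have "\<dots> = ?q 0 + ?q 1 + ?q 2 + ?q 3"
    by (simp add: eval_nat_numeral)
  also have "\<dots> = 0"
    using x
  proof
    assume "x \<in> {0} \<times> {0<..<pi / 2}"
    then obtain y where "x = (0, y)" by auto
    then show ?thesis
      by (simp add: mode_normal_deriv_def frechet_derivative_sin_mode outward_normal_def
          freq1_def freq2_def mode_coeff_def)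
  next
    assume "x \<in> {0<..<pi} \<times> {pi / 2}"
    \<comment> \<open>Strict bounds exclude both corners, so that \<open>outward_normal\<close>
      selects (0, 1) rather than a horizontal vector.\<close>
    then obtain y where "x = (y, pi / 2)" "0 < y" "y < pi" by auto
    then show ?thesis
      by (simp add: mode_normal_deriv_def frechet_derivative_sin_mode outward_normal_def
          freq1_def freq2_def mode_coeff_def)
  qed
  finally show ?thesis .
qed

text \<open>From the zero initial state every reachable y(1) annihilates \<zeta> and so lies in a
  fixed closed hyperplane, whereas the target pairs with \<zeta> to a nonzero number.\<close>

lemma not_approx_controllable:
  assumes n: "n \<ge> 4"
  shows "\<not> approx_controllable pi (pi / 2) ({0} \<times> {0<..<pi / 2} \<union> {0<..<pi} \<times> {pi / 2})
    (diag_of n (\<lambda>i. complex_of_real ((freq1 i)\<^sup>2 + (freq2 i)\<^sup>2))) (ones_mat n)"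
    (is "\<not> approx_controllable _ _ ?\<gamma> ?A ?B")
proof
  assume ac: "approx_controllable pi (pi / 2) ?\<gamma> ?A ?B"
  let ?S = "rectangle pi (pi / 2)"
  define \<zeta> where "\<zeta> = (\<lambda>i x. mode_coeff i * sin_mode (freq1 i) (freq2 i) x)"
  define z where "z = (\<lambda>i (p :: real \<times> real \<times> real). mode_coeff i * sin_mode (freq1 i) (freq2 i) (snd p))"
  define q where "q = (\<lambda>i (p :: real \<times> real \<times> real).
    mode_normal_deriv pi (pi / 2) (freq1 i) (freq2 i) (mode_coeff i) (snd p))"
  \<comment> \<open>The target lives in the component of the lowest mode, which has no zero inside
    the rectangle; pairing with \<zeta> then leaves \<open>P\<close>, the squared L^2 norm of
    \<open>\<zeta> 0\<close>.\<close>
  define y1 where "y1 = (\<lambda>(i::nat) u. if i = 0 then (\<integral>x. \<zeta> 0 x * cnj (u x) \<partial>lborel_on ?S) else 0)"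
  define K where "K = (\<Sum>i<n. H1_norm ?S (\<zeta> i))"
  define P where "P = (\<integral>x. \<zeta> 0 x * cnj (\<zeta> 0 x) \<partial>lborel_on ?S)"
  have P: "P \<noteq> 0"
    unfolding P_def \<zeta>_def
    by (rule sin_mode_L2_nonzero) (auto simp: freq1_def freq2_def mode_coeff_def)
  have K: "K \<ge> 0"
    unfolding K_def by (intro sum_nonneg H1_norm_nonneg)
  have \<zeta>: "\<zeta> i \<in> H10 ?S" for i
    unfolding \<zeta>_def by (rule sin_mode_H10[OF sin_freq])
  have y1: "y1 i \<in> Hm1 ?S" for i
  proof (cases "i = 0")
    case True
    have "(\<lambda>u. \<integral>x. \<zeta> 0 x * cnj (u x) \<partial>lborel_on ?S) \<in> Hm1 ?S"
    proof (rule pairing_in_Hm1[OF open_rectangle bounded_rectangle])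
      show "\<zeta> 0 \<in> borel_measurable borel"
        unfolding \<zeta>_def
        by (intro borel_measurable_continuous_onI smooth_fun_continuous_on smooth_fun_mult
            smooth_fun_const smooth_sin_mode)
      have "\<bar>sin s * sin t\<bar> \<le> 1" for s t :: real
        unfolding abs_mult by (intro mult_le_one) auto
      then show "cmod (\<zeta> 0 x) \<le> 4" for x
        by (simp add: \<zeta>_def mode_coeff_def sin_mode_def norm_mult abs_mult)
    qed
    then show ?thesis
      using True by (simp add: y1_def[abs_def])
  next
    case False
    then show ?thesis
      using zero_in_Hm1 by (simp add: y1_def[abs_def])
  qed
  \<comment> \<open>Chosen so that \<epsilon> K < |P|; adding 1 to \<open>K\<close> avoids a
    division by zero.\<close>
  define \<epsilon> where "\<epsilon> = cmod P / (2 * (K + 1))"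
  have \<epsilon>: "\<epsilon> > 0"
    using P K by (simp add: \<epsilon>_def)
  have dims: "dim_row ?A = n" "dim_col ?B = 1"
    by (simp_all add: ones_mat_def)
  from ac have "approx_controllable_at pi (pi / 2) ?\<gamma> ?A ?B 1"
    by (simp add: approx_controllable_def)
  note at_1 = this[unfolded approx_controllable_at_def dims, THEN spec, THEN spec, THEN spec, THEN mp, THEN mp, OF \<epsilon>]
  have "\<exists>g y. (\<forall>j<1. square_integrable (boundary_cylinder_measure pi (pi / 2) 1) (g j)) \<and>
      transposition_solution pi (pi / 2) ?\<gamma> ?A ?B 1 (\<lambda>_ _. 0) g y \<and>
      Hm1_norm_vec n ?S (\<lambda>i \<zeta>. y 1 i \<zeta> - y1 i \<zeta>) \<le> \<epsilon>"
    by (rule at_1) (intro allI impI conjI zero_in_Hm1 y1)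
  then obtain g y where sol: "transposition_solution pi (pi / 2) ?\<gamma> ?A ?B 1 (\<lambda>_ _. 0) g y"
    and close: "Hm1_norm_vec n ?S (\<lambda>i \<zeta>. y 1 i \<zeta> - y1 i \<zeta>) \<le> \<epsilon>"
    by (elim exE conjE)
  have adj: "adjoint_solution pi (pi / 2) ?A 1 \<zeta> z"
    unfolding \<zeta>_def z_def by (rule stationary_adjoint_solution[OF sin_freq])
  have nd: "has_lateral_normal_deriv n pi (pi / 2) 1 z q"
    unfolding q_def z_def by (rule stationary_lateral_normal_deriv)
  have y_Hm1: "y 1 i \<in> Hm1 ?S" if "i < n" for i
    using sol that unfolding transposition_solution_def dims by auto
  \<comment> \<open>\<open>B\<close> is a column of ones, so the single control multiplies the
    conjugate of the summed normal derivatives, which is 0 on the controlled sides; elsewhere the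
    indicator is 0.\<close>
  have integrand: "indicator ?\<gamma> (snd p) *\<^sub>R ((?B *\<^sub>v vec 1 (\<lambda>j. g j p)) \<bullet>c vec n (\<lambda>i. q i p)) = 0" for p
  proof (cases "snd p \<in> ?\<gamma>")
    case True
    have "(?B *\<^sub>v vec 1 (\<lambda>j. g j p)) \<bullet>c vec n (\<lambda>i. q i p) = (\<Sum>i<n. g 0 p * cnj (q i p))"
      by (simp add: scalar_prod_def ones_mat_def lessThan_atLeast0)
    also have "\<dots> = g 0 p * cnj (\<Sum>i<n. q i p)"
      by (simp add: sum_distrib_left)
    also have "\<dots> = 0"
      using normal_deriv_sum_zero[OF n True] by (simp add: q_def)
    finally show ?thesis by simp
  qed simp
  \<comment> \<open>Transposition identity at the final time 1; the second sum is the zero initial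
    state paired with z(0).\<close>
  have "(\<Sum>i<n. y 1 i (\<zeta> i)) - (\<Sum>i<n. 0) =
        - (\<integral>p. indicator ?\<gamma> (snd p) *\<^sub>R ((?B *\<^sub>v vec 1 (\<lambda>j. g j p)) \<bullet>c vec n (\<lambda>i. q i p))
            \<partial>boundary_cylinder_measure pi (pi / 2) 1)"
    using sol adj nd \<zeta> unfolding transposition_solution_def dims by auto
  then have y0: "(\<Sum>i<n. y 1 i (\<zeta> i)) = 0"
    unfolding integrand by simp
  have "(\<Sum>i<n. y1 i (\<zeta> i)) = P"
    using n by (simp add: y1_def P_def sum.delta if_distrib[of "\<lambda>f. f _"])
  then have "cmod P = cmod (\<Sum>i<n. y 1 i (\<zeta> i) - y1 i (\<zeta> i))"
    by (simp add: sum_subtractf y0)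
  also have "\<dots> \<le> Hm1_norm_vec n ?S (\<lambda>i \<zeta>. y 1 i \<zeta> - y1 i \<zeta>) * K"
    unfolding K_def
    using Hm1_norm_vec_bound[of n "\<lambda>i \<zeta>. y 1 i \<zeta> - y1 i \<zeta>" ?S \<zeta>] Hm1_diff[OF y_Hm1 y1] \<zeta> by blast
  also have "\<dots> \<le> \<epsilon> * K"
    by (rule mult_right_mono[OF close K])
  also have "\<dots> < cmod P"
  proof -
    have "K / (2 * (K + 1)) < 1"
      using K by (simp add: divide_less_eq)
    then have "cmod P * (K / (2 * (K + 1))) < cmod P * 1"
      using P by (intro mult_strict_left_mono) auto
    then show ?thesis
      by (simp add: \<epsilon>_def)
  qed
  finally show False by simp
qed

theorem theorem2p17:
  fixes n :: nat
  assumes "n \<ge> 4"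
  shows "\<exists>X1 X2 :: real. X1 > 0 \<and> X2 > 0 \<and>
    (\<exists>m\<ge>1. \<exists>A\<in>carrier_mat n n. \<exists>B\<in>carrier_mat n m.
      (\<forall>\<theta>. eigenvalue (mat_adjoint A) \<theta> \<longrightarrow>
         mat_kernel (\<theta> \<cdot>\<^sub>m 1\<^sub>m n - mat_adjoint A) \<inter> mat_kernel (mat_adjoint B) = {0\<^sub>v n}) \<and>
      \<not> approx_controllable X1 X2 ({0} \<times> {0<..<X2} \<union> {0<..<X1} \<times> {X2}) A B)"
proof (intro exI conjI bexI allI impI)
  show "pi > 0" "pi / 2 > 0" by simp_all
  show "(1::nat) \<ge> 1" by simp
  show "diag_of n (\<lambda>i. complex_of_real ((freq1 i)\<^sup>2 + (freq2 i)\<^sup>2)) \<in> carrier_mat n n"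
    "ones_mat n \<in> carrier_mat n 1"
    by (simp_all add: diag_of_def ones_mat_def)
  show "\<not> approx_controllable pi (pi / 2) ({0} \<times> {0<..<pi / 2} \<union> {0<..<pi} \<times> {pi / 2})
    (diag_of n (\<lambda>i. complex_of_real ((freq1 i)\<^sup>2 + (freq2 i)\<^sup>2))) (ones_mat n)"
    by (rule not_approx_controllable[OF assms])
qed (rule fattorini_diag_ones[OF inj_mode_eigenvalue])

end
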